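(* Let $N\ge 1$ and $m\ge 1$ be integers. Let $f\in L_2(\mathbb{R}^N)$ and let $\Omega\subset\mathbb{R}^N$ be an open set such that $f(x)=0$ for almost every $x\in\Omega$. Then $$E_\lambda f(x)=(2\pi)^{-\frac N2}\int_{|\xi|^{2m}<\lambda}\hat f(\xi)e^{i(x,\xi)}\,d\xi \longrightarrow 0 \quad (\lambda\to\infty)$$ for almost every $x\in\Omega$.
   Context: $\hat f(\xi)=(2\pi)^{-N/2}\int_{\mathbb{R}^N}f(x)e^{-i(x,\xi)}dx$ denotes the (unitary, $L_2$-extended) Fourier transform and $(x,\xi)$ the Euclidean inner product. For $f\in L_2(\mathbb{R}^N)$ and $\lambda>0$, $\hat f$ restricted to the bounded set $\{|\xi|^{2m}<\lambda\}$ is integrable, so $E_\lambda f(x)$ is defined for every $x$. $E_\lambda$ is the spectral projection (decomposition of the identity) of the self-adjoint extension in $L_2(\mathbb{R}^N)$ of the polyharmonic operator $(-\Delta)^m$, $\Delta=\sum_{j=1}^N\partial^2/\partial x_j^2$. *)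

theory Defs
  imports "HOL-Analysis.Analysis"
begin

text \<open>Functions on R^N are modelled on an arbitrary Euclidean space 'a, N = DIM('a).\<close>

definition L2_fun :: "('a::euclidean_space \<Rightarrow> complex) \<Rightarrow> bool" where
  "L2_fun f \<longleftrightarrow> f \<in> borel_measurable lborel \<and>
     integrable lborel (\<lambda>x. (cmod (f x))\<^sup>2)"

definition fourier_trunc :: "('a::euclidean_space \<Rightarrow> complex) \<Rightarrow> real \<Rightarrow> 'a \<Rightarrow> complex" where
  "fourier_trunc f R \<xi> = complex_of_real ((2 * pi) powr (- real DIM('a) / 2)) *
     set_lebesgue_integral lborel (ball 0 R)
       (\<lambda>x. f x * exp (- \<i> * complex_of_real (x \<bullet> \<xi>)))"

text \<open>g is (a representative of) the unitary L2 Fourier transform of f (Plancherel):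
  g is square integrable and the truncated transforms converge to g in L2 as R tends to infinity.\<close>
definition is_L2_fourier :: "('a::euclidean_space \<Rightarrow> complex) \<Rightarrow> ('a \<Rightarrow> complex) \<Rightarrow> bool" where
  "is_L2_fourier f g \<longleftrightarrow> L2_fun g \<and>
     ((\<lambda>R. \<integral>\<^sup>+ \<xi>. ennreal ((cmod (fourier_trunc f R \<xi> - g \<xi>))\<^sup>2) \<partial>lborel) \<longlongrightarrow> 0) at_top"

text \<open>Spectral projection of (-Delta)^m: E_lambda f(x), computed from the Fourier transform g of f.\<close>
definition spectral_proj :: "nat \<Rightarrow> ('a::euclidean_space \<Rightarrow> complex) \<Rightarrow> real \<Rightarrow> 'a \<Rightarrow> complex" where
  "spectral_proj m g lam x = complex_of_real ((2 * pi) powr (- real DIM('a) / 2)) *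
     set_lebesgue_integral lborel {\<xi>. norm \<xi> ^ (2 * m) < lam}
       (\<lambda>\<xi>. g \<xi> * exp (\<i> * complex_of_real (x \<bullet> \<xi>)))"

end

theory Submission
  imports Defs "HOL-Probability.Levy"
begin

text \<open>
  Let \<open>S\<^sub>R(x)\<close> be the integral of \<open>g(\<xi>) e\<^sup>i\<^sup>x\<^sup>\<xi>\<close> over the ball of radius \<open>R\<close>. All \<open>L\<^sup>2\<close> bounds come from
  one Schur-test estimate with a Gaussian weight in \<open>x\<close>: if \<open>h\<close> lives on a set \<open>A\<close>, the weighted square
  norm of its Fourier integral is at most a constant times the norm of \<open>h\<close> squared times the largest
  Gaussian mass of \<open>A\<close>.

  Integer radii: choose \<open>\<Phi>\<close> with integral 1, finite first moment and Fourier transform supported in the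
  \<open>\<epsilon>\<close>-ball. If \<open>f = 0\<close> on the \<open>\<epsilon>\<close>-ball about \<open>x\<close>, the indicator of the ball of radius \<open>k\<close> may be replaced,
  in \<open>S\<^sub>k(x)\<close>, by its difference with its convolution with \<open>\<Phi>\<close>. That difference is concentrated near
  the sphere of radius \<open>k\<close>, so the sum over \<open>k\<close> of its square is bounded; hence the weighted square norms
  of these integrals are summable and \<open>S\<^sub>k(x)\<close> tends to 0 almost everywhere.

  Between integers: a shell of thickness \<open>h\<close> has Gaussian mass \<open>O(h)\<close>, uniformly in its radius. Cutting
  \<open>k \<le> |\<xi>| < k + 1\<close> into shells of thickness \<open>1/n\<close>, Cauchy--Schwarz bounds the sum of the absolute
  values of their contributions by the norm of \<open>g\<close> on that unit shell, uniformly in \<open>n\<close>. So the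
  oscillation of \<open>S\<^sub>R\<close> on \<open>[k, k + 1]\<close> is square summable over \<open>k\<close>, whether or not \<open>f\<close> vanishes anywhere.
\<close>

section \<open>Lebesgue integration on Euclidean spaces\<close>

lemma integrable_lborel_affine:
  fixes f :: "'a::euclidean_space \<Rightarrow> 'b::{banach, second_countable_topology}"
  assumes f: "integrable lborel f" and c: "c \<noteq> 0"
  shows "integrable lborel (\<lambda>x. f (t + c *\<^sub>R x))"
proof -
  have [measurable]: "f \<in> borel_measurable borel"
    using borel_measurable_integrable[OF f] by simp
  have "integrable (density (distr lborel borel (\<lambda>x. t + c *\<^sub>R x)) (\<lambda>_. \<bar>c\<bar>^DIM('a))) f"
    using f lborel_affine[OF c, of t] by simp
  then have "integrable lborel (\<lambda>x. \<bar>c\<bar>^DIM('a) *\<^sub>R f (t + c *\<^sub>R x))"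
    by (subst (asm) integrable_density) (auto simp: integrable_distr_eq)
  then have "integrable lborel (\<lambda>x. (1 / \<bar>c\<bar>^DIM('a)) *\<^sub>R (\<bar>c\<bar>^DIM('a) *\<^sub>R f (t + c *\<^sub>R x)))"
    by (rule integrable_scaleR_right)
  then show ?thesis using c by simp
qed

lemma integral_lborel_affine:
  fixes f :: "'a::euclidean_space \<Rightarrow> 'b::{banach, second_countable_topology}"
  assumes f[measurable]: "f \<in> borel_measurable borel" and c: "c \<noteq> 0"
  shows "integral\<^sup>L lborel f = \<bar>c\<bar>^DIM('a) *\<^sub>R (\<integral>x. f (t + c *\<^sub>R x) \<partial>lborel)"
proof -
  have "integral\<^sup>L lborel f = integral\<^sup>L (density (distr lborel borel (\<lambda>x. t + c *\<^sub>R x)) (\<lambda>_. \<bar>c\<bar>^DIM('a))) f"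
    using lborel_affine[OF c, of t] by simp
  also have "\<dots> = (\<integral>x. \<bar>c\<bar>^DIM('a) *\<^sub>R f (t + c *\<^sub>R x) \<partial>lborel)"
    by (subst integral_density) (auto simp: integral_distr)
  finally show ?thesis by simp
qed

lemma nn_integral_lborel_reflect:
  fixes f :: "'a::euclidean_space \<Rightarrow> ennreal"
  assumes f[measurable]: "f \<in> borel_measurable borel"
  shows "(\<integral>\<^sup>+x. f (t - x) \<partial>lborel) = integral\<^sup>N lborel f"
proof -
  have "integral\<^sup>N lborel f = integral\<^sup>N (density (distr lborel borel (\<lambda>x. t + (-1) *\<^sub>R x)) (\<lambda>_. 1)) f"
    by (rule arg_cong[where f="\<lambda>M. integral\<^sup>N M f"]) (use lborel_affine[of "-1" t] in simp)
  also have "\<dots> = (\<integral>\<^sup>+x. f (t - x) \<partial>lborel)"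
    by (subst nn_integral_density) (auto simp: nn_integral_distr)
  finally show ?thesis by simp
qed

text \<open>Fubini: by \<open>lborel_eq\<close> Lebesgue measure is the image of the product of
  one-dimensional measures under the coordinate map. The Gaussian and the localizing kernel are
  products over \<open>Basis\<close> and reduce to dimension one this way.\<close>

lemma
  fixes f :: "'a::euclidean_space \<Rightarrow> real \<Rightarrow> 'b::{real_normed_field, banach, second_countable_topology}"
  assumes f: "\<And>b. b \<in> Basis \<Longrightarrow> integrable lborel (f b)"
  shows integrable_lborel_prod_Basis: "integrable lborel (\<lambda>x. \<Prod>b\<in>Basis. f b (x \<bullet> b))"
    and integral_lborel_prod_Basis:
      "(\<integral>x. (\<Prod>b\<in>Basis. f b (x \<bullet> b)) \<partial>lborel) = (\<Prod>b\<in>Basis. integral\<^sup>L lborel (f b))"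
proof -
  interpret product_sigma_finite "\<lambda>_::'a. lborel :: real measure"
    by (simp add: product_sigma_finite_def lborel.sigma_finite_measure_axioms)
  have [measurable]: "f b \<in> borel_measurable borel" if "b \<in> Basis" for b
    using borel_measurable_integrable[OF f[OF that]] by simp
  have m: "(\<lambda>x. \<Sum>b\<in>Basis. x b *\<^sub>R b) \<in> Pi\<^sub>M (Basis::'a set) (\<lambda>_. lborel) \<rightarrow>\<^sub>M borel"
    by measurable
  have pm: "(\<lambda>x. \<Prod>b\<in>Basis. f b (x \<bullet> b)) \<in> borel_measurable borel"
    by measurable
  have eq: "(\<Prod>b\<in>Basis. f b ((\<Sum>c\<in>Basis. x c *\<^sub>R c) \<bullet> b)) = (\<Prod>b\<in>Basis. f b (x b))"
    for x :: "'a \<Rightarrow> real"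
    by (rule prod.cong) simp_all
  show "integrable lborel (\<lambda>x. \<Prod>b\<in>Basis. f b (x \<bullet> b))"
    unfolding lborel_eq[where 'a='a] integrable_distr_eq[OF m pm] eq
    by (rule product_integrable_prod) (auto intro: f)
  show "(\<integral>x. (\<Prod>b\<in>Basis. f b (x \<bullet> b)) \<partial>lborel) = (\<Prod>b\<in>Basis. integral\<^sup>L lborel (f b))"
    unfolding lborel_eq[where 'a='a] integral_distr[OF m pm] eq
    by (rule product_integral_prod) (auto intro: f)
qed

text \<open>Domination by \<open>cmod (u x) * cmod (v y)\<close>. With \<open>K\<close> a unimodular
  exponential this justifies interchanging integrals; with \<open>K\<close> constantly 1 it makes a
  tensor product integrable.\<close>

lemma integrable_bounded_kernel:
  fixes u :: "'a::euclidean_space \<Rightarrow> complex" and v :: "'b::euclidean_space \<Rightarrow> complex"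
  assumes u: "integrable lborel u" and v: "integrable lborel v"
    and K[measurable]: "(\<lambda>(x, y). K x y) \<in> borel_measurable borel"
    and K1: "\<And>x y. cmod (K x y) \<le> 1"
  shows "integrable (lborel \<Otimes>\<^sub>M lborel) (\<lambda>(x, y). u x * v y * K x y)"
proof -
  have [measurable]: "u \<in> borel_measurable borel" "v \<in> borel_measurable borel"
    using borel_measurable_integrable[OF u] borel_measurable_integrable[OF v] by simp_all
  have uv: "integrable (lborel \<Otimes>\<^sub>M lborel) (\<lambda>(x, y). u x * v y)"
    by (rule lborel_pair.Fubini_integrable)
       (use u v in \<open>auto simp: norm_mult intro!: integrable_mult_right\<close>)
  have [measurable]: "(\<lambda>(x, y). K x y) \<in> borel_measurable (lborel \<Otimes>\<^sub>M lborel)"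
    using K by (simp add: lborel_prod)
  show ?thesis
    by (rule Bochner_Integration.integrable_bound[OF uv])
       (auto simp: norm_mult intro!: mult_left_le K1 AE_I2)
qed

lemma integral_swap_bounded_kernel:
  fixes u :: "'a::euclidean_space \<Rightarrow> complex" and v :: "'b::euclidean_space \<Rightarrow> complex"
  assumes u: "integrable lborel u" and v: "integrable lborel v"
    and K: "(\<lambda>(x, y). K x y) \<in> borel_measurable borel"
    and K1: "\<And>x y. cmod (K x y) \<le> 1"
  shows "(\<integral>x. u x * (\<integral>y. v y * K x y \<partial>lborel) \<partial>lborel) =
         (\<integral>y. v y * (\<integral>x. u x * K x y \<partial>lborel) \<partial>lborel)"
proof -
  have "(\<integral>x. u x * (\<integral>y. v y * K x y \<partial>lborel) \<partial>lborel) = (\<integral>x. (\<integral>y. u x * v y * K x y \<partial>lborel) \<partial>lborel)"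
    by (simp add: mult.assoc)
  also have "\<dots> = (\<integral>y. (\<integral>x. u x * v y * K x y \<partial>lborel) \<partial>lborel)"
    by (rule lborel_pair.Fubini_integral[OF integrable_bounded_kernel[OF assms], symmetric])
  also have "\<dots> = (\<integral>y. (\<integral>x. v y * (u x * K x y) \<partial>lborel) \<partial>lborel)"
    by (simp add: mult_ac)
  finally show ?thesis by simp
qed

lemma integrable_exp_square: "c > 0 \<Longrightarrow> integrable lborel (\<lambda>t::real. exp (- c * t\<^sup>2))"
  using integrable_mult_right[OF integrable_normal_density[of "sqrt (1 / (2 * c))" 0], of "sqrt (pi / c)"]
  by (auto simp: normal_density_def real_sqrt_divide field_simps)

lemma exp_norm_square_prod:
  fixes x :: "'a::euclidean_space"
  shows "exp (- c * (norm x)\<^sup>2) = (\<Prod>b\<in>Basis. exp (- c * (x \<bullet> b)\<^sup>2))"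
proof -
  have "- c * (norm x)\<^sup>2 = (\<Sum>b\<in>Basis. - c * (x \<bullet> b)\<^sup>2)"
    unfolding power2_norm_eq_inner euclidean_inner[of x x] by (simp add: power2_eq_square sum_distrib_left)
  then show ?thesis by (simp only: exp_sum[OF finite_Basis])
qed

section \<open>A Gaussian-weighted bound for Fourier integrals\<close>

lemma integrable_exp_norm_square:
  "c > 0 \<Longrightarrow> integrable lborel (\<lambda>x::'a::euclidean_space. exp (- c * (norm x)\<^sup>2))"
  unfolding exp_norm_square_prod by (rule integrable_lborel_prod_Basis) (rule integrable_exp_square)

lemma integrable_gaussian: "integrable lborel (\<lambda>x::'a::euclidean_space. exp (- (norm x)\<^sup>2 / 2))"
  using integrable_exp_norm_square[of "1/2", where 'a='a] by simp

lemma integrable_gaussian_moment: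
  "integrable lborel (\<lambda>x::'a::euclidean_space. norm x * exp (- (norm x)\<^sup>2 / 2))"
proof (rule Bochner_Integration.integrable_bound)
  show "integrable lborel (\<lambda>x::'a. exp (- (1/4) * (norm x)\<^sup>2))"
    by (rule integrable_exp_norm_square) simp
  have "r * exp (- r\<^sup>2 / 2) \<le> exp (- (1/4) * r\<^sup>2)" for r :: real
  proof -
    \<comment> \<open>The factor \<open>r\<close> is absorbed by half of the Gaussian exponent:
      \<open>r \<le> 1 + r\<^sup>2 / 4 \<le> exp (r\<^sup>2 / 4)\<close>.\<close>
    have "0 \<le> (1 - r / 2)\<^sup>2" by simp
    then have "r \<le> 1 + r\<^sup>2 / 4" by (simp add: power2_eq_square algebra_simps)
    also have "\<dots> \<le> exp (r\<^sup>2 / 4)" by (rule exp_ge_add_one_self)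
    finally have "r * exp (- r\<^sup>2 / 2) \<le> exp (r\<^sup>2 / 4) * exp (- r\<^sup>2 / 2)" by simp
    also have "\<dots> = exp (- (1/4) * r\<^sup>2)" by (simp add: exp_add[symmetric])
    finally show ?thesis .
  qed
  then show "AE x::'a in lborel. norm (norm x * exp (- (norm x)\<^sup>2 / 2)) \<le> norm (exp (- (1/4) * (norm x)\<^sup>2))"
    by auto
qed measurable

lemma fourier_gaussian_real:
  "(\<integral>t. complex_of_real (exp (- t\<^sup>2 / 2)) * iexp (t * s) \<partial>lborel) =
    complex_of_real (sqrt (2 * pi) * exp (- s\<^sup>2 / 2))"
proof -
  have "(\<integral>t. complex_of_real (exp (- t\<^sup>2 / 2)) * iexp (t * s) \<partial>lborel) =
     (\<integral>t. complex_of_real (sqrt (2 * pi)) * (std_normal_density t *\<^sub>R iexp (s * t)) \<partial>lborel)"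
    by (rule Bochner_Integration.integral_cong)
       (auto simp: std_normal_density_def scaleR_conv_of_real field_simps)
  also have "\<dots> = complex_of_real (sqrt (2 * pi)) * (\<integral>t. std_normal_density t *\<^sub>R iexp (s * t) \<partial>lborel)"
    by (rule integral_mult_right_zero)
  also have "(\<integral>t. std_normal_density t *\<^sub>R iexp (s * t) \<partial>lborel) = char std_normal_distribution s"
    unfolding char_def by (subst integral_density) auto
  finally show ?thesis by (simp add: char_std_normal_distribution)
qed

lemma iexp_inner_eq_prod: "iexp (x \<bullet> \<xi>) = (\<Prod>b\<in>Basis. iexp ((x \<bullet> b) * (\<xi> \<bullet> b)))"
  by (simp add: exp_sum[symmetric] euclidean_inner[of x \<xi>] sum_distrib_left)

lemma fourier_gaussian:
  fixes \<xi> :: "'a::euclidean_space"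
  shows "(\<integral>x. complex_of_real (exp (- (norm x)\<^sup>2 / 2)) * iexp (x \<bullet> \<xi>) \<partial>lborel) =
    complex_of_real (sqrt (2 * pi) ^ DIM('a) * exp (- (norm \<xi>)\<^sup>2 / 2))"
proof -
  have prod_eq: "exp (- (norm x)\<^sup>2 / 2) = (\<Prod>b\<in>Basis. exp (- (x \<bullet> b)\<^sup>2 / 2))" for x :: 'a
    using exp_norm_square_prod[of "1/2" x] by simp
  have "(\<integral>x. complex_of_real (exp (- (norm x)\<^sup>2 / 2)) * iexp (x \<bullet> \<xi>) \<partial>lborel) =
     (\<integral>x. (\<Prod>b\<in>Basis. complex_of_real (exp (- (x \<bullet> b)\<^sup>2 / 2)) * iexp ((x \<bullet> b) * (\<xi> \<bullet> b))) \<partial>lborel)"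
    unfolding prod_eq iexp_inner_eq_prod prod.distrib of_real_prod ..
  also have "\<dots> = (\<Prod>b\<in>Basis. \<integral>t. complex_of_real (exp (- t\<^sup>2 / 2)) * iexp (t * (\<xi> \<bullet> b)) \<partial>lborel)"
  proof (rule integral_lborel_prod_Basis)
    fix b :: 'a
    show "integrable lborel (\<lambda>t. complex_of_real (exp (- t\<^sup>2 / 2)) * iexp (t * (\<xi> \<bullet> b)))"
      by (rule Bochner_Integration.integrable_bound[OF integrable_exp_square[of "1/2"]])
         (auto simp: norm_mult)
  qed
  also have "\<dots> = complex_of_real (sqrt (2 * pi) ^ DIM('a) * exp (- (norm \<xi>)\<^sup>2 / 2))"
    unfolding fourier_gaussian_real prod_eq by (simp add: prod.distrib)
  finally show ?thesis .
qed

lemma integrable_mult_iexp: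
  fixes h :: "'a::euclidean_space \<Rightarrow> complex"
  assumes "integrable lborel h"
  shows "integrable lborel (\<lambda>\<xi>. h \<xi> * iexp (x \<bullet> \<xi>))"
  by (rule Bochner_Integration.integrable_bound[OF assms])
     (use borel_measurable_integrable[OF assms] in \<open>auto simp: norm_mult\<close>)

section \<open>Schur test and the weighted bound\<close>

lemma measurable_fourier_integral:
  fixes h :: "'a::euclidean_space \<Rightarrow> complex"
  assumes [measurable]: "h \<in> borel_measurable borel"
  shows "(\<lambda>x. \<integral>\<xi>. h \<xi> * iexp (x \<bullet> \<xi>) \<partial>lborel) \<in> borel_measurable borel"
  by measurable

text \<open>Schur test: \<open>2 * u \<xi> * u \<eta>\<close> is at most the sum of the squares, and
  since \<open>w\<close> is even the two resulting double integrals agree by Tonelli. As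
  \<open>u\<close> vanishes off \<open>A\<close>, the other variable can be kept in
  \<open>A\<close>, so only the mass of \<open>w\<close> over \<open>A\<close> enters.\<close>

lemma nn_integral_schur_bound:
  fixes u w :: "'a::euclidean_space \<Rightarrow> real"
  assumes [measurable]: "u \<in> borel_measurable borel" "w \<in> borel_measurable borel" "A \<in> sets borel"
    and nonneg: "\<And>x. 0 \<le> u x" "\<And>x. 0 \<le> w x" and even: "\<And>x. w (- x) = w x"
    and u0: "\<And>x. x \<notin> A \<Longrightarrow> u x = 0"
    and D: "\<And>\<xi>. (\<integral>\<^sup>+\<eta>. indicator A \<eta> * ennreal (w (\<xi> - \<eta>)) \<partial>lborel) \<le> D"
  shows "(\<integral>\<^sup>+\<xi>. \<integral>\<^sup>+\<eta>. ennreal (u \<xi> * u \<eta> * w (\<xi> - \<eta>)) \<partial>lborel \<partial>lborel) \<le> D * (\<integral>\<^sup>+\<xi>. ennreal ((u \<xi>)\<^sup>2) \<partial>lborel)"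
proof -
  let ?k = "\<lambda>\<xi> \<eta>. ennreal ((u \<xi>)\<^sup>2) * (indicator A \<eta> * ennreal (w (\<xi> - \<eta>)))"
  have even': "w (\<xi> - \<eta>) = w (\<eta> - \<xi>)" for \<xi> \<eta>
    using even[of "\<xi> - \<eta>"] by simp
  have pt: "2 * ennreal (u \<xi> * u \<eta> * w (\<xi> - \<eta>)) \<le> ?k \<xi> \<eta> + ?k \<eta> \<xi>" for \<xi> \<eta>
  proof (cases "\<xi> \<in> A \<and> \<eta> \<in> A")
    case True
    have "2 * ennreal (u \<xi> * u \<eta> * w (\<xi> - \<eta>)) = ennreal (2 * (u \<xi> * u \<eta> * w (\<xi> - \<eta>)))"
      using nonneg by (subst ennreal_mult) auto
    also have "2 * (u \<xi> * u \<eta> * w (\<xi> - \<eta>)) \<le> ((u \<xi>)\<^sup>2 + (u \<eta>)\<^sup>2) * w (\<xi> - \<eta>)"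
      using mult_right_mono[OF sum_squares_bound[of "u \<xi>" "u \<eta>"] nonneg(2)[of "\<xi> - \<eta>"]]
      by (simp add: mult.assoc)
    then have "ennreal (2 * (u \<xi> * u \<eta> * w (\<xi> - \<eta>))) \<le> ennreal (((u \<xi>)\<^sup>2 + (u \<eta>)\<^sup>2) * w (\<xi> - \<eta>))"
      by (rule ennreal_leI)
    also have "\<dots> = ?k \<xi> \<eta> + ?k \<eta> \<xi>"
      using True nonneg by (simp add: distrib_right ennreal_mult even'[of \<eta> \<xi>])
    finally show ?thesis .
  qed (auto simp: u0)
  have k_le: "(\<integral>\<^sup>+\<xi>. \<integral>\<^sup>+\<eta>. ?k \<xi> \<eta> \<partial>lborel \<partial>lborel) \<le> D * (\<integral>\<^sup>+\<xi>. ennreal ((u \<xi>)\<^sup>2) \<partial>lborel)"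
  proof -
    have "(\<integral>\<^sup>+\<xi>. \<integral>\<^sup>+\<eta>. ?k \<xi> \<eta> \<partial>lborel \<partial>lborel) \<le> (\<integral>\<^sup>+\<xi>. D * ennreal ((u \<xi>)\<^sup>2) \<partial>lborel)"
      by (rule nn_integral_mono) (auto simp: nn_integral_cmult mult.commute[of D] intro!: mult_left_mono D)
    then show ?thesis by (simp add: nn_integral_cmult)
  qed
  have "2 * (\<integral>\<^sup>+\<xi>. \<integral>\<^sup>+\<eta>. ennreal (u \<xi> * u \<eta> * w (\<xi> - \<eta>)) \<partial>lborel \<partial>lborel)
      = (\<integral>\<^sup>+\<xi>. \<integral>\<^sup>+\<eta>. 2 * ennreal (u \<xi> * u \<eta> * w (\<xi> - \<eta>)) \<partial>lborel \<partial>lborel)"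
    by (simp add: nn_integral_cmult)
  also have "\<dots> \<le> (\<integral>\<^sup>+\<xi>. \<integral>\<^sup>+\<eta>. ?k \<xi> \<eta> + ?k \<eta> \<xi> \<partial>lborel \<partial>lborel)"
    by (intro nn_integral_mono pt)
  also have "\<dots> = (\<integral>\<^sup>+\<xi>. \<integral>\<^sup>+\<eta>. ?k \<xi> \<eta> \<partial>lborel \<partial>lborel) + (\<integral>\<^sup>+\<xi>. \<integral>\<^sup>+\<eta>. ?k \<eta> \<xi> \<partial>lborel \<partial>lborel)"
    by (subst nn_integral_add[symmetric]) (auto intro!: nn_integral_cong nn_integral_add)
  also have "(\<integral>\<^sup>+\<xi>. \<integral>\<^sup>+\<eta>. ?k \<eta> \<xi> \<partial>lborel \<partial>lborel) = (\<integral>\<^sup>+\<xi>. \<integral>\<^sup>+\<eta>. ?k \<xi> \<eta> \<partial>lborel \<partial>lborel)"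
    by (rule lborel_pair.Fubini') measurable
  also have "\<dots> + \<dots> \<le> 2 * (D * (\<integral>\<^sup>+\<xi>. ennreal ((u \<xi>)\<^sup>2) \<partial>lborel))"
    unfolding mult_2 by (intro add_mono k_le)
  finally show ?thesis
    by (simp add: ennreal_mult_le_mult_iff)
qed

text \<open>Writing the squared modulus as a double integral and integrating over \<open>x\<close>
  first turns the Gaussian into its Fourier transform, again a Gaussian, evaluated at
  \<open>\<xi> - \<eta>\<close>. The Schur test then applies. The weight makes the integral over
  \<open>x\<close> converge absolutely and, being positive, does not affect statements about almost
  every \<open>x\<close>.\<close>

lemma gaussian_weighted_fourier_bound:
  fixes h :: "'a::euclidean_space \<Rightarrow> complex"
  assumes h: "integrable lborel h" and A: "A \<in> sets borel"
    and h0: "\<And>\<xi>. \<xi> \<notin> A \<Longrightarrow> h \<xi> = 0"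
    and D: "\<And>\<xi>. (\<integral>\<^sup>+\<eta>. indicator A \<eta> * ennreal (exp (- (norm (\<xi> - \<eta>))\<^sup>2 / 2)) \<partial>lborel) \<le> D"
  shows "(\<integral>\<^sup>+x. ennreal (exp (- (norm x)\<^sup>2 / 2) * (cmod (\<integral>\<xi>. h \<xi> * iexp (x \<bullet> \<xi>) \<partial>lborel))\<^sup>2) \<partial>lborel)
    \<le> ennreal (sqrt (2 * pi) ^ DIM('a)) * (D * (\<integral>\<^sup>+\<xi>. ennreal ((cmod (h \<xi>))\<^sup>2) \<partial>lborel))"
proof -
  let ?w = "\<lambda>x::'a. exp (- (norm x)\<^sup>2 / 2)"
  define F where "F x = (\<integral>\<xi>. h \<xi> * iexp (x \<bullet> \<xi>) \<partial>lborel)" for x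
  \<comment> \<open>The two frequencies are packed into one variable of the product space, so that
    \<open>integral_swap_bounded_kernel\<close> exchanges \<open>x\<close> with both at
    once.\<close>
  define H where "H p = h (fst p) * cnj (h (snd p))" for p :: "'a \<times> 'a"
  have hm[measurable]: "h \<in> borel_measurable borel"
    using borel_measurable_integrable[OF h] by simp
  have Fm[measurable]: "F \<in> borel_measurable borel"
    unfolding F_def by (rule measurable_fourier_integral[OF hm])
  have H: "integrable lborel H"
    using integrable_bounded_kernel[of h "\<lambda>\<eta>. cnj (h \<eta>)" "\<lambda>_ _. 1"] h
    by (simp add: lborel_prod H_def[abs_def] case_prod_beta')
  have FF: "complex_of_real ((cmod (F x))\<^sup>2) = (\<integral>p. H p * iexp (x \<bullet> (fst p - snd p)) \<partial>lborel)" for x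
  proof -
    let ?v = "\<lambda>\<xi>. h \<xi> * iexp (x \<bullet> \<xi>)"
    have v: "integrable lborel ?v" by (rule integrable_mult_iexp[OF h])
    then have "integrable lborel (\<lambda>\<eta>. cnj (?v \<eta>))" by (simp only: complex_integrable_cnj)
    from integrable_bounded_kernel[OF v this, of "\<lambda>_ _. 1"]
    have vv: "integrable (lborel \<Otimes>\<^sub>M lborel) (\<lambda>p. ?v (fst p) * cnj (?v (snd p)))"
      by (simp add: case_prod_beta')
    have "complex_of_real ((cmod (F x))\<^sup>2) = F x * cnj (F x)"
      by (rule complex_norm_square)
    also have "\<dots> = (\<integral>\<xi>. ?v \<xi> * (\<integral>\<eta>. cnj (?v \<eta>) \<partial>lborel) \<partial>lborel)"
      unfolding F_def
      by (simp only: integral_bounded_linear[OF bounded_linear_cnj v] integral_mult_left_zero)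
    also have "\<dots> = (\<integral>\<xi>. (\<integral>\<eta>. ?v \<xi> * cnj (?v \<eta>) \<partial>lborel) \<partial>lborel)"
      by (simp only: integral_mult_right_zero)
    also have "\<dots> = (\<integral>p. ?v (fst p) * cnj (?v (snd p)) \<partial>(lborel \<Otimes>\<^sub>M lborel))"
      using lborel_pair.integral_fst'[OF vv] by (simp only: fst_conv snd_conv)
    also have "\<dots> = (\<integral>p. H p * iexp (x \<bullet> (fst p - snd p)) \<partial>lborel)"
      unfolding lborel_prod
      by (rule Bochner_Integration.integral_cong)
         (auto simp: H_def exp_cnj inner_diff_right ring_distribs exp_diff exp_minus field_simps)
    finally show ?thesis .
  qed
  have wm: "(\<lambda>p::'a \<times> 'a. ?w (fst p - snd p)) \<in> borel_measurable borel"
    by (intro borel_measurable_continuous_onI) (auto intro!: continuous_intros)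
  \<comment> \<open>\<open>F\<close> is bounded by the L1 norm of \<open>h\<close>, so the weighted
    square is integrable and its nonnegative integral may be computed as a Bochner integral.\<close>
  have Fb: "cmod (F x) \<le> (\<integral>\<xi>. cmod (h \<xi>) \<partial>lborel)" for x
    unfolding F_def using integral_norm_bound[of lborel "\<lambda>\<xi>. h \<xi> * iexp (x \<bullet> \<xi>)"]
    by (simp add: norm_mult)
  have wF: "integrable lborel (\<lambda>x. ?w x * (cmod (F x))\<^sup>2)"
  proof (rule Bochner_Integration.integrable_bound)
    show "integrable lborel (\<lambda>x. (\<integral>\<xi>. cmod (h \<xi>) \<partial>lborel)\<^sup>2 * ?w x)"
      by (intro integrable_mult_right integrable_gaussian)
    show "AE x in lborel. norm (?w x * (cmod (F x))\<^sup>2) \<le> norm ((\<integral>\<xi>. cmod (h \<xi>) \<partial>lborel)\<^sup>2 * ?w x)"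
      by (intro AE_I2) (auto simp: mult.commute intro!: mult_left_mono power_mono Fb)
  qed measurable
  have "complex_of_real (\<integral>x. ?w x * (cmod (F x))\<^sup>2 \<partial>lborel)
      = (\<integral>x. complex_of_real (?w x) * (\<integral>p. H p * iexp (x \<bullet> (fst p - snd p)) \<partial>lborel) \<partial>lborel)"
    by (simp add: integral_complex_of_real[symmetric] FF[symmetric])
  also have "\<dots> = (\<integral>p. H p * (\<integral>x. complex_of_real (?w x) * iexp (x \<bullet> (fst p - snd p)) \<partial>lborel) \<partial>lborel)"
  proof (rule integral_swap_bounded_kernel)
    show "(\<lambda>(x, p). iexp (x \<bullet> (fst p - snd p))) \<in> borel_measurable (borel :: ('a \<times> 'a \<times> 'a) measure)"
      by (intro borel_measurable_continuous_onI) (auto simp: case_prod_beta' intro!: continuous_intros)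
  qed (use H integrable_gaussian in auto)
  also have "\<dots> = (\<integral>p. H p * complex_of_real (sqrt (2 * pi) ^ DIM('a) * ?w (fst p - snd p)) \<partial>lborel)"
    unfolding fourier_gaussian ..
  finally have eq: "complex_of_real (\<integral>x. ?w x * (cmod (F x))\<^sup>2 \<partial>lborel) = \<dots>" .
  have "(\<integral>\<^sup>+x. ennreal (?w x * (cmod (F x))\<^sup>2) \<partial>lborel) = ennreal (\<integral>x. ?w x * (cmod (F x))\<^sup>2 \<partial>lborel)"
    by (rule nn_integral_eq_integral[OF wF]) simp
  also have "\<dots> \<le> ennreal (cmod (complex_of_real (\<integral>x. ?w x * (cmod (F x))\<^sup>2 \<partial>lborel)))"
    by (intro ennreal_leI) simp
  also have "\<dots> \<le> (\<integral>\<^sup>+p. ennreal (cmod (H p * complex_of_real (sqrt (2 * pi) ^ DIM('a) * ?w (fst p - snd p)))) \<partial>lborel)"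
    unfolding eq
  proof (rule integral_norm_bound_ennreal)
    show "integrable lborel (\<lambda>p. H p * complex_of_real (sqrt (2 * pi) ^ DIM('a) * ?w (fst p - snd p)))"
    proof (rule Bochner_Integration.integrable_bound)
      show "integrable lborel (\<lambda>p. complex_of_real (sqrt (2 * pi) ^ DIM('a)) * H p)"
        by (intro integrable_mult_right H)
      show "AE p in lborel. norm (H p * complex_of_real (sqrt (2 * pi) ^ DIM('a) * ?w (fst p - snd p)))
            \<le> norm (complex_of_real (sqrt (2 * pi) ^ DIM('a)) * H p)"
        by (intro AE_I2) (auto simp: norm_mult mult.assoc[symmetric] mult.commute[of "cmod (H _)"] intro!: mult_left_le_one_le)
    qed (use borel_measurable_integrable[OF H] wm in auto)
  qed
  also have "\<dots> = (\<integral>\<^sup>+p. ennreal (sqrt (2 * pi) ^ DIM('a)) * ennreal (cmod (h (fst p)) * cmod (h (snd p)) * ?w (fst p - snd p)) \<partial>lborel)"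
    by (auto intro!: nn_integral_cong simp: ennreal_mult[symmetric] H_def norm_mult norm_power abs_mult mult_ac)
  also have "\<dots> = ennreal (sqrt (2 * pi) ^ DIM('a)) * (\<integral>\<^sup>+p. ennreal (cmod (h (fst p)) * cmod (h (snd p)) * ?w (fst p - snd p)) \<partial>lborel)"
    unfolding lborel_prod[symmetric] by (rule nn_integral_cmult) measurable
  also have "(\<integral>\<^sup>+p. ennreal (cmod (h (fst p)) * cmod (h (snd p)) * ?w (fst p - snd p)) \<partial>lborel)
      = (\<integral>\<^sup>+\<xi>. \<integral>\<^sup>+\<eta>. ennreal (cmod (h \<xi>) * cmod (h \<eta>) * ?w (\<xi> - \<eta>)) \<partial>lborel \<partial>lborel)"
    unfolding lborel_prod[symmetric]
    by (subst lborel.nn_integral_fst[symmetric]) auto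
  also have "\<dots> \<le> D * (\<integral>\<^sup>+\<xi>. ennreal ((cmod (h \<xi>))\<^sup>2) \<partial>lborel)"
    by (rule nn_integral_schur_bound[where A=A]) (use A D h0 in auto)
  finally show ?thesis
    unfolding F_def by (simp add: mult_left_mono)
qed

section \<open>Gaussian mass of thin shells\<close>

text \<open>Half-open, so that consecutive shells tile and \<open>shell 0 R\<close> is the open
  ball, matching the strict inequality in \<open>spectral_proj\<close>.\<close>

definition shell :: "real \<Rightarrow> real \<Rightarrow> 'a::euclidean_space set" where
  "shell a b = {\<xi>. a \<le> norm \<xi> \<and> norm \<xi> < b}"

lemma shell_sets [measurable]: "shell a b \<in> sets borel"
  unfolding shell_def by measurable

text \<open>With \<open>u\<close> half the increase of the squared norm, the difference is the
  Gaussian at \<open>z\<close> times \<open>1 - exp (- u)\<close>, and this last factor is at most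
  \<open>u\<close> for either sign of \<open>u\<close>. Keeping the Gaussian at \<open>z\<close> on
  the right makes the bound integrable in \<open>z\<close>.\<close>

lemma gaussian_difference_le:
  fixes z z' :: "'a::real_normed_vector"
  assumes "norm (z - z') \<le> s" "s \<le> 1"
  shows "exp (- (norm z)\<^sup>2 / 2) - exp (- (norm z')\<^sup>2 / 2) \<le> s * ((norm z + 1) * exp (- (norm z)\<^sup>2 / 2))"
proof -
  define u where "u = ((norm z')\<^sup>2 - (norm z)\<^sup>2) / 2"
  have s0: "0 \<le> s" using assms norm_ge_zero order_trans by blast
  have "norm z' \<le> norm z + s"
    using assms norm_triangle_ineq4[of z "z - z'"] by simp
  then have "(norm z')\<^sup>2 \<le> (norm z + s)\<^sup>2" by (intro power_mono) auto
  then have "u \<le> s * norm z + s\<^sup>2 / 2" by (simp add: u_def power2_sum mult_ac)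
  also have "s\<^sup>2 \<le> s" using assms s0 by (simp add: power2_eq_square mult_left_le)
  finally have u: "u \<le> s * (norm z + 1)" using s0 by (simp add: algebra_simps)
  have "exp (- (norm z')\<^sup>2 / 2) = exp (- (norm z)\<^sup>2 / 2) * exp (- u)"
    by (simp add: u_def exp_add[symmetric] field_simps)
  moreover have "1 - exp (- u) \<le> u" using exp_ge_add_one_self[of "- u"] by simp
  ultimately have "exp (- (norm z)\<^sup>2 / 2) - exp (- (norm z')\<^sup>2 / 2) \<le> exp (- (norm z)\<^sup>2 / 2) * u"
    using mult_left_mono[of "1 - exp (- u)" u "exp (- (norm z)\<^sup>2 / 2)"] by (simp add: algebra_simps)
  also have "\<dots> \<le> exp (- (norm z)\<^sup>2 / 2) * (s * (norm z + 1))"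
    by (intro mult_left_mono u) simp
  finally show ?thesis by (simp add: mult_ac)
qed

lemma one_minus_power_le: "0 \<le> t \<Longrightarrow> t \<le> 1 \<Longrightarrow> 1 - t ^ n \<le> real n * (1 - t)" for t :: real
  using Bernoulli_inequality[of "t - 1" n] by (simp add: algebra_simps)

text \<open>The ball of radius \<open>a\<close> is the dilate of the ball of radius \<open>b\<close> by \<open>a / b\<close>, which moves no point
  of the latter by more than \<open>b - a\<close>.\<close>

lemma gaussian_shell_bound:
  "\<exists>C\<ge>0. \<forall>a b. \<forall>\<xi>::'a::euclidean_space. 1 \<le> a \<longrightarrow> a \<le> b \<longrightarrow> b \<le> a + 1 \<longrightarrow>
     (\<integral>\<^sup>+\<eta>. indicator (shell a b) \<eta> * ennreal (exp (- (norm (\<xi> - \<eta>))\<^sup>2 / 2)) \<partial>lborel)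
       \<le> ennreal (C * (b - a))"
proof -
  let ?w = "\<lambda>z::'a. exp (- (norm z)\<^sup>2 / 2)"
  \<comment> \<open>The summand \<open>real DIM('a)\<close> pays for the Jacobian of the dilation,
    through \<open>one_minus_power_le\<close>; \<open>norm z + 1\<close> comes from
    \<open>gaussian_difference_le\<close>.\<close>
  define W where "W z = (norm z + (1 + real DIM('a))) * ?w z" for z :: 'a
  have W_eq: "W = (\<lambda>z. norm z * ?w z + (1 + real DIM('a)) * ?w z)"
    by (simp add: W_def fun_eq_iff distrib_right)
  have W: "integrable lborel W" unfolding W_eq
    by (intro Bochner_Integration.integrable_add integrable_gaussian_moment integrable_mult_right integrable_gaussian)
  have W0: "0 \<le> W z" for z by (simp add: W_def)
  have [measurable]: "W \<in> borel_measurable borel" unfolding W_def[abs_def] by measurable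
  have main: "(\<integral>\<^sup>+\<eta>. indicator (shell a b) \<eta> * ennreal (?w (\<xi> - \<eta>)) \<partial>lborel) \<le> ennreal (integral\<^sup>L lborel W * (b - a))"
    if ab: "1 \<le> a" "a \<le> b" "b \<le> a + 1" for a b and \<xi> :: 'a
  proof -
    define t where "t = a / b"
    have t: "0 < t" "t \<le> 1" using ab by (auto simp: t_def)
    have tb: "(1 - t) * b = b - a" using ab by (simp add: t_def field_simps)
    \<comment> \<open>Here \<open>1 \<le> a\<close> enters: since \<open>b \<ge> 1\<close>, the
      relative contraction \<open>1 - t\<close> is at most the thickness, whatever the
      radius.\<close>
    have t1: "1 - t \<le> b - a"
      using tb ab t mult_left_mono[of 1 b "1 - t"] by simp
    have ball_t: "indicator (ball 0 a) (t *\<^sub>R \<eta>) = (indicator (ball 0 b) \<eta> :: real)" for \<eta> :: 'a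
      using ab by (auto simp: indicator_def t_def field_simps)
    let ?u = "\<lambda>\<eta>. ?w (\<xi> - \<eta>)"
    have u: "integrable lborel ?u"
      using integrable_lborel_affine[OF integrable_gaussian, of "-1" \<xi>] by simp
    have ub: "integrable lborel (\<lambda>\<eta>. indicator (ball 0 r) \<eta> * ?u \<eta>)" for r
      using integrable_real_mult_indicator[of "ball 0 r" lborel ?u] u by (simp add: mult.commute)
    have ut: "integrable lborel (\<lambda>\<eta>. indicator (ball 0 b) \<eta> * ?u (t *\<^sub>R \<eta>))"
      using integrable_lborel_affine[OF ub[of a], of t 0] t by (simp add: ball_t)
    have scale: "(\<integral>\<eta>. indicator (ball 0 a) \<eta> * ?u \<eta> \<partial>lborel)
        = t ^ DIM('a) * (\<integral>\<eta>. indicator (ball 0 b) \<eta> * ?u (t *\<^sub>R \<eta>) \<partial>lborel)"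
      using t borel_measurable_integrable[OF ub[of a]]
      by (subst integral_lborel_affine[where c=t and t=0]) (simp_all add: ball_t)
    have WR: "integrable lborel (\<lambda>\<eta>. (b - a) * W (\<xi> - \<eta>))"
      using integrable_lborel_affine[OF W, of "-1" \<xi>] by simp
    have pt: "indicator (ball 0 b) \<eta> * ?u \<eta> - t ^ DIM('a) * (indicator (ball 0 b) \<eta> * ?u (t *\<^sub>R \<eta>))
        \<le> (b - a) * W (\<xi> - \<eta>)" for \<eta>
    proof (cases "norm \<eta> < b")
      case True
      have "norm ((\<xi> - \<eta>) - (\<xi> - t *\<^sub>R \<eta>)) = (1 - t) * norm \<eta>"
      proof -
        have "(\<xi> - \<eta>) - (\<xi> - t *\<^sub>R \<eta>) = - ((1 - t) *\<^sub>R \<eta>)" by (simp add: algebra_simps)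
        then show ?thesis using t by (simp only: norm_minus_cancel norm_scaleR)
      qed
      also have "\<dots> \<le> b - a" unfolding tb[symmetric] using t True by (intro mult_left_mono) auto
      finally have d: "?u \<eta> - ?u (t *\<^sub>R \<eta>) \<le> (b - a) * ((norm (\<xi> - \<eta>) + 1) * ?u \<eta>)"
        by (rule gaussian_difference_le) (use ab in simp)
      \<comment> \<open>Jacobian defect of the dilation plus displacement of the Gaussian; each is
        at most \<open>b - a\<close> times an integrable function of
        \<open>\<xi> - \<eta>\<close>.\<close>
      have "?u \<eta> - t ^ DIM('a) * ?u (t *\<^sub>R \<eta>) = (1 - t ^ DIM('a)) * ?u \<eta> + t ^ DIM('a) * (?u \<eta> - ?u (t *\<^sub>R \<eta>))"
        by (simp add: algebra_simps)
      also have "\<dots> \<le> (real DIM('a) * (b - a)) * ?u \<eta> + 1 * ((b - a) * ((norm (\<xi> - \<eta>) + 1) * ?u \<eta>))"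
      proof (intro add_mono mult_right_mono)
        have "1 - t ^ DIM('a) \<le> real DIM('a) * (1 - t)" using t by (intro one_minus_power_le) auto
        also have "\<dots> \<le> real DIM('a) * (b - a)" using t1 by (intro mult_left_mono) auto
        finally show "1 - t ^ DIM('a) \<le> real DIM('a) * (b - a)" .
        have "t ^ DIM('a) * (?u \<eta> - ?u (t *\<^sub>R \<eta>)) \<le> t ^ DIM('a) * ((b - a) * ((norm (\<xi> - \<eta>) + 1) * ?u \<eta>))"
          using t d by (intro mult_left_mono) auto
        also have "\<dots> \<le> 1 * ((b - a) * ((norm (\<xi> - \<eta>) + 1) * ?u \<eta>))"
          using t ab by (intro mult_right_mono) (auto intro: power_le_one)
        finally show "t ^ DIM('a) * (?u \<eta> - ?u (t *\<^sub>R \<eta>)) \<le> 1 * ((b - a) * ((norm (\<xi> - \<eta>) + 1) * ?u \<eta>))" .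
      qed simp
      also have "\<dots> = (b - a) * W (\<xi> - \<eta>)" by (simp add: W_def algebra_simps)
      finally show ?thesis using True by simp
    qed (use ab W0 in auto)
    have sh: "indicator (shell a b) \<eta> = indicator (ball 0 b) \<eta> - (indicator (ball 0 a) \<eta> :: real)" for \<eta> :: 'a
      using ab by (auto simp: indicator_def shell_def)
    have "(\<integral>\<^sup>+\<eta>. indicator (shell a b) \<eta> * ennreal (?u \<eta>) \<partial>lborel)
        = (\<integral>\<^sup>+\<eta>. ennreal (indicator (shell a b) \<eta> * ?u \<eta>) \<partial>lborel)"
      by (intro nn_integral_cong) (auto simp: indicator_def)
    also have "\<dots> = ennreal (\<integral>\<eta>. indicator (shell a b) \<eta> * ?u \<eta> \<partial>lborel)"
      using integrable_real_mult_indicator[of "shell a b" lborel ?u] u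
      by (intro nn_integral_eq_integral) (auto simp: mult.commute)
    also have "(\<integral>\<eta>. indicator (shell a b) \<eta> * ?u \<eta> \<partial>lborel)
        = (\<integral>\<eta>. indicator (ball 0 b) \<eta> * ?u \<eta> - t ^ DIM('a) * (indicator (ball 0 b) \<eta> * ?u (t *\<^sub>R \<eta>)) \<partial>lborel)"
      unfolding sh left_diff_distrib using ub ut scale
      by (subst (1 2) Bochner_Integration.integral_diff) auto
    also have "\<dots> \<le> (\<integral>\<eta>. (b - a) * W (\<xi> - \<eta>) \<partial>lborel)"
      by (rule integral_mono) (use ub ut WR pt in auto)
    also have "\<dots> = integral\<^sup>L lborel W * (b - a)"
      using integral_lborel_affine[of W "-1" \<xi>] by simp
    finally show ?thesis by (simp add: ennreal_leI)
  qed
  show ?thesis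
    by (intro exI[of _ "integral\<^sup>L lborel W"] conjI allI impI main Bochner_Integration.integral_nonneg W0)
qed

section \<open>A kernel with compactly supported Fourier transform\<close>

text \<open>The density vanishes at \<open>-1\<close> and \<open>1\<close>, so the characteristic function is \<open>O(t\<^sup>-\<^sup>2)\<close>.\<close>

definition parabolic_law :: "real measure" where
  "parabolic_law = density lborel (\<lambda>x. ennreal (3 / 4 * (1 - x\<^sup>2)) * indicator {-1..1} x)"

lemma real_distribution_parabolic_law: "real_distribution parabolic_law"
proof -
  have "(\<integral>\<^sup>+x. ennreal (3 / 4 * (1 - x\<^sup>2)) * indicator {-1..1::real} x \<partial>lborel)
      = ennreal ((3 / 4 * (1 - 1 / 3)) - (3 / 4 * (- 1 + 1 / 3)))"
  proof (subst nn_integral_FTC_Icc[where F="\<lambda>x. 3 / 4 * (x - x ^ 3 / 3)"])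
    show "((\<lambda>x. 3 / 4 * (x - x ^ 3 / 3)) has_real_derivative 3 / 4 * (1 - x\<^sup>2)) (at x)" for x :: real
      by (auto intro!: derivative_eq_intros)
    show "0 \<le> 3 / 4 * (1 - x\<^sup>2)" if "x \<in> {-1..1}" for x :: real
      using that abs_square_le_1[of x] by auto
  qed auto
  then have "prob_space parabolic_law"
    by (intro prob_spaceI) (simp add: parabolic_law_def emeasure_density)
  then show ?thesis
    by (simp add: real_distribution_def real_distribution_axioms_def parabolic_law_def)
qed

lemma char_parabolic_law_le:
  assumes "\<bar>t\<bar> \<ge> 1"
  shows "cmod (char parabolic_law t) \<le> 6 / t\<^sup>2"
proof -
  define s where "s = \<i> * complex_of_real t"
  have s0: "s \<noteq> 0" using assms by (auto simp: s_def)
  have ns: "cmod s = \<bar>t\<bar>" by (simp add: s_def norm_mult)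
  \<comment> \<open>A primitive found by repeated integration by parts. At both endpoints the term
    of order \<open>1 / s\<close> drops out because \<open>1 - x\<^sup>2\<close> vanishes
    there.\<close>
  let ?F = "\<lambda>x::real. exp (s * complex_of_real x) * (complex_of_real (1 - x\<^sup>2) / s + 2 * complex_of_real x / s\<^sup>2 - 2 / s ^ 3)"
  have deriv: "(?F has_vector_derivative (complex_of_real (1 - x\<^sup>2) * exp (s * complex_of_real x))) (at x within S)" for x S
  proof -
    have "((\<lambda>z. exp (s * z) * ((1 - z\<^sup>2) / s + 2 * z / s\<^sup>2 - 2 / s ^ 3)) has_field_derivative
        ((1 - (complex_of_real x)\<^sup>2) * exp (s * complex_of_real x))) (at (complex_of_real x))"
      by (rule derivative_eq_intros refl | use s0 in \<open>simp; fail\<close>)+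
         (use s0 in \<open>simp add: field_simps power2_eq_square power3_eq_cube\<close>)
    from field_vector_diff_chain_at[OF has_vector_derivative_of_real[OF DERIV_ident] this]
    show ?thesis
      by (auto simp: o_def intro: has_vector_derivative_at_within)
  qed
  have "char parabolic_law t = (\<integral>x. (3 / 4 * (1 - x\<^sup>2) * indicator {-1..1} x) *\<^sub>R iexp (t * x) \<partial>lborel)"
  proof -
    have "parabolic_law = density lborel (\<lambda>x. ennreal (3 / 4 * (1 - x\<^sup>2) * indicator {-1..1} x))"
      unfolding parabolic_law_def by (intro density_cong) (auto simp: indicator_def)
    moreover have "0 \<le> 3 / 4 * (1 - x\<^sup>2) * indicator {-1..1} x" for x :: real
      by (auto simp: indicator_def abs_square_le_1 abs_le_iff)
    ultimately show ?thesis
      unfolding char_def by (subst integral_density[symmetric]) auto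
  qed
  also have "\<dots> = (\<integral>x. (3 / 4) * (indicator {-1..1} x *\<^sub>R (complex_of_real (1 - x\<^sup>2) * exp (s * complex_of_real x))) \<partial>lborel)"
    by (intro Bochner_Integration.integral_cong) (auto simp: s_def scaleR_conv_of_real indicator_def mult_ac)
  also have "\<dots> = (3 / 4) * (?F 1 - ?F (-1))"
    unfolding integral_mult_right_zero
    by (subst integral_FTC_Icc[OF _ deriv]) (auto intro!: continuous_intros)
  also have "?F 1 - ?F (-1) = exp s * (2 / s\<^sup>2 - 2 / s ^ 3) + exp (- s) * (2 / s\<^sup>2 + 2 / s ^ 3)"
    by (simp add: algebra_simps)
  finally have eq: "char parabolic_law t = (3 / 4) * (exp s * (2 / s\<^sup>2 - 2 / s ^ 3) + exp (- s) * (2 / s\<^sup>2 + 2 / s ^ 3))" .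
  have e: "Re s = 0" by (simp add: s_def)
  have p3: "2 / \<bar>t\<bar> ^ 3 \<le> 2 / t\<^sup>2"
  proof -
    have "\<bar>t\<bar> ^ 2 \<le> \<bar>t\<bar> ^ 3" using assms by (intro power_increasing) auto
    then show ?thesis using assms by (intro divide_left_mono) auto
  qed
  have "cmod (2 / s\<^sup>2 - 2 / s ^ 3) \<le> 4 / t\<^sup>2"
    using norm_triangle_ineq4[of "2 / s\<^sup>2" "2 / s ^ 3"] p3 by (simp add: norm_divide norm_power ns)
  moreover have "cmod (2 / s\<^sup>2 + 2 / s ^ 3) \<le> 4 / t\<^sup>2"
    using norm_triangle_ineq[of "2 / s\<^sup>2" "2 / s ^ 3"] p3 by (simp add: norm_divide norm_power ns)
  ultimately have "cmod (exp s * (2 / s\<^sup>2 - 2 / s ^ 3) + exp (- s) * (2 / s\<^sup>2 + 2 / s ^ 3)) \<le> 8 / t\<^sup>2"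
    using norm_triangle_ineq[of "exp s * (2 / s\<^sup>2 - 2 / s ^ 3)" "exp (- s) * (2 / s\<^sup>2 + 2 / s ^ 3)"]
    by (simp add: norm_mult e)
  then show ?thesis unfolding eq norm_mult[of "3 / 4"] by (simp add: norm_divide)
qed

text \<open>Where \<open>\<bar>x\<bar> \<ge> 1\<close>, \<open>ennreal\<close> sends the nonpositive
  \<open>1 - x\<^sup>2\<close> to 0, endpoints included. The spare point \<open>c\<close> makes
  singletons null, as Levy's inversion formula requires at the ends of its interval.\<close>

lemma measure_parabolic_law_null:
  assumes "A \<in> sets borel" "\<And>x. x \<in> A \<Longrightarrow> x = c \<or> \<bar>x\<bar> \<ge> 1"
  shows "measure parabolic_law A = 0"
proof -
  have "AE x in lborel. x \<noteq> c" by (rule AE_lborel_singleton)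
  then have "AE x in lborel. \<not> (ennreal (3 / 4 * (1 - x\<^sup>2)) * indicator {-1..1} x * indicator A x \<noteq> 0)"
  proof eventually_elim
    fix x :: real assume x: "x \<noteq> c"
    show "\<not> (ennreal (3 / 4 * (1 - x\<^sup>2)) * indicator {-1..1} x * indicator A x \<noteq> 0)"
    proof (cases "x \<in> A")
      case True
      then have "1 \<le> \<bar>x\<bar>" using assms(2) x by auto
      then have "1 \<le> x\<^sup>2" using abs_square_less_1[of x] by linarith
      then show ?thesis by (simp add: ennreal_neg)
    qed simp
  qed
  then have "emeasure parabolic_law A = 0"
    unfolding parabolic_law_def using assms(1)
    by (subst emeasure_density) (auto simp: nn_integral_0_iff_AE)
  then show ?thesis by (simp add: measure_def)
qed

text \<open>This is \<open>sin t / (pi * t)\<close> times the characteristic function of the law. At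
  \<open>t = 0\<close> the quotient is 0 instead of its limit, which changes only a null
  set.\<close>

definition parabolic_kernel :: "real \<Rightarrow> complex" where
  "parabolic_kernel t = (iexp t - iexp (- t)) / (\<i> * t) * char parabolic_law t / complex_of_real (2 * pi)"

lemma measurable_parabolic_kernel [measurable]: "parabolic_kernel \<in> borel_measurable borel"
proof -
  interpret real_distribution parabolic_law by (rule real_distribution_parabolic_law)
  show ?thesis unfolding parabolic_kernel_def[abs_def] by measurable
qed

text \<open>The sinc factor decays like \<open>1 / \<bar>t\<bar>\<close> and the characteristic
  function like \<open>1 / t\<^sup>2\<close>. One power is spent on the first moment, and an
  integrable majorant remains.\<close>

lemma parabolic_kernel_bound: "(1 + \<bar>t\<bar>) * cmod (parabolic_kernel t) \<le> 8 * inverse (1 + t\<^sup>2)"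
proof -
  interpret real_distribution parabolic_law by (rule real_distribution_parabolic_law)
  let ?q = "(iexp t - iexp (- t)) / (\<i> * t)"
  have norm_eq: "cmod (parabolic_kernel t) = cmod ?q * cmod (char parabolic_law t) / (2 * pi)"
    by (simp add: parabolic_kernel_def norm_mult norm_divide)
  have pi: "2 \<le> 2 * pi" "6 \<le> 2 * pi" using pi_gt3 by simp_all
  show ?thesis
  proof (cases "\<bar>t\<bar> \<ge> 1")
    case True
    have "cmod (iexp t - iexp (- t)) \<le> 2"
      using norm_triangle_ineq4[of "iexp t" "iexp (- t)"] by simp
    then have q: "cmod ?q \<le> 2 / \<bar>t\<bar>"
      by (simp add: norm_divide norm_mult divide_right_mono)
    have "cmod ?q * cmod (char parabolic_law t) \<le> (2 / \<bar>t\<bar>) * (6 / t\<^sup>2)"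
      by (intro mult_mono q char_parabolic_law_le[OF True]) auto
    then have "cmod (parabolic_kernel t) \<le> (2 / \<bar>t\<bar>) * (6 / t\<^sup>2) / 6"
      unfolding norm_eq using pi by (intro frac_le) auto
    then have "(1 + \<bar>t\<bar>) * cmod (parabolic_kernel t) \<le> (2 * \<bar>t\<bar>) * ((2 / \<bar>t\<bar>) * (6 / t\<^sup>2) / 6)"
      using True by (intro mult_mono) auto
    also have "\<dots> = 4 / t\<^sup>2" using True by (simp add: field_simps)
    also have "\<dots> \<le> 8 * inverse (1 + t\<^sup>2)"
    proof -
      have "1 \<le> t\<^sup>2" using True abs_square_less_1[of t] by linarith
      then have "8 / (2 * t\<^sup>2) \<le> 8 / (1 + t\<^sup>2)"
        using True by (intro divide_left_mono mult_pos_pos add_pos_nonneg) auto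
      then show ?thesis by (simp add: inverse_eq_divide)
    qed
    finally show ?thesis .
  next
    case False
    have q: "cmod ?q \<le> 2"
    proof (cases "t = 0")
      case False
      \<comment> \<open>The quotient is the Fourier transform of the interval from -1 to 1, hence
        bounded by its length 2.\<close>
      then show ?thesis using Levy_Inversion_aux2[of "-1" 1 t] by simp
    qed simp
    have "cmod ?q * cmod (char parabolic_law t) \<le> 2 * 1"
      by (intro mult_mono q cmod_char_le_1) auto
    then have "cmod ?q * cmod (char parabolic_law t) / (2 * pi) \<le> 2 * 1 / 2"
      using pi by (intro frac_le) auto
    then have "(1 + \<bar>t\<bar>) * cmod (parabolic_kernel t) \<le> 2 * 1"
      using False unfolding norm_eq by (intro mult_mono) auto
    also have "\<dots> \<le> 8 * inverse (1 + t\<^sup>2)"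
    proof -
      have "t\<^sup>2 \<le> 1" using False abs_square_le_1[of t] by simp
      then show ?thesis by (simp add: field_simps add_pos_nonneg)
    qed
    finally show ?thesis .
  qed
qed

lemma integrable_parabolic_majorant: "integrable lborel (\<lambda>t::real. 8 * inverse (1 + t\<^sup>2))"
  using integrable_inverse_1_plus_square by (simp add: set_integrable_def)

lemma integrable_parabolic_kernel: "integrable lborel parabolic_kernel"
proof (rule Bochner_Integration.integrable_bound[OF integrable_parabolic_majorant])
  have "cmod (parabolic_kernel t) \<le> 8 * inverse (1 + t\<^sup>2)" for t
    using parabolic_kernel_bound[of t] mult_right_mono[of 1 "1 + \<bar>t\<bar>" "cmod (parabolic_kernel t)"] by simp
  then show "AE t in lborel. norm (parabolic_kernel t) \<le> norm (8 * inverse (1 + t\<^sup>2))" by simp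
qed simp

lemma integrable_parabolic_kernel_moment: "integrable lborel (\<lambda>t. complex_of_real t * parabolic_kernel t)"
proof (rule Bochner_Integration.integrable_bound[OF integrable_parabolic_majorant])
  have "cmod (complex_of_real t * parabolic_kernel t) \<le> 8 * inverse (1 + t\<^sup>2)" for t
    using parabolic_kernel_bound[of t] mult_right_mono[of "\<bar>t\<bar>" "1 + \<bar>t\<bar>" "cmod (parabolic_kernel t)"]
    by (simp add: norm_mult)
  then show "AE t in lborel. norm (complex_of_real t * parabolic_kernel t) \<le> norm (8 * inverse (1 + t\<^sup>2))" by simp
qed simp

text \<open>Convolving the law with an interval multiplies its characteristic function by a sinc factor,
  so Levy's inversion formula for intervals reads as a Fourier inversion formula for this kernel.\<close>

lemma fourier_parabolic_kernel:
  "(\<integral>t. parabolic_kernel t * iexp (u * t) \<partial>lborel) = complex_of_real (measure parabolic_law {- u - 1<..- u + 1})"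
proof -
  interpret real_distribution parabolic_law by (rule real_distribution_parabolic_law)
  let ?f = "\<lambda>t. parabolic_kernel t * iexp (u * t)"
  have f: "integrable lborel ?f"
    using integrable_parabolic_kernel by (rule Bochner_Integration.integrable_bound) (auto simp: norm_mult)
  have [measurable]: "?f \<in> borel_measurable borel" by measurable
  \<comment> \<open>Levy's integrand for the interval of length 2 centred at \<open>- u\<close>; the
    centre contributes the phase \<open>iexp (u * t)\<close>.\<close>
  have eq: "(iexp (-(t * (- u - 1))) - iexp (-(t * (- u + 1)))) / (\<i> * t) * char parabolic_law t
      = complex_of_real (2 * pi) * ?f t" for t
  proof -
    have "iexp (-(t * (- u - 1))) = iexp (u * t) * iexp t" "iexp (-(t * (- u + 1))) = iexp (u * t) * iexp (- t)"
      by (simp_all add: exp_add[symmetric] algebra_simps)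
    then show ?thesis
      by (simp add: parabolic_kernel_def right_diff_distrib[symmetric] del: of_real_mult)
  qed
  have "(\<lambda>T. 1 / (2 * pi) * (CLBINT t=-T..T. (iexp (-(t * (- u - 1))) - iexp (-(t * (- u + 1)))) / (\<i> * t) * char parabolic_law t))
      \<longlonglongrightarrow> complex_of_real (measure parabolic_law {- u - 1<..- u + 1})"
    by (rule Levy_Inversion) (auto intro!: measure_parabolic_law_null)
  moreover have "1 / (2 * pi) * (CLBINT t=-T..T. (iexp (-(t * (- u - 1))) - iexp (-(t * (- u + 1)))) / (\<i> * t) * char parabolic_law t)
      = (\<integral>t. indicator {- real T<..<real T} t *\<^sub>R ?f t \<partial>lborel)" for T :: nat
  proof -
    have "(CLBINT t=-T..T. complex_of_real (2 * pi) * ?f t)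
       = complex_of_real (2 * pi) * (\<integral>t. indicator {- real T<..<real T} t *\<^sub>R ?f t \<partial>lborel)"
      by (simp add: interval_lebesgue_integral_def set_lebesgue_integral_def del: of_real_mult)
    then show ?thesis unfolding eq by simp
  qed
  ultimately have lim1: "(\<lambda>T. \<integral>t. indicator {- real T<..<real T} t *\<^sub>R ?f t \<partial>lborel)
      \<longlonglongrightarrow> complex_of_real (measure parabolic_law {- u - 1<..- u + 1})" by simp
  \<comment> \<open>Levy's formula is a limit of integrals over symmetric intervals; integrability
    of the kernel identifies that limit with the integral over the line.\<close>
  have lim2: "(\<lambda>T. \<integral>t. indicator {- real T<..<real T} t *\<^sub>R ?f t \<partial>lborel) \<longlonglongrightarrow> integral\<^sup>L lborel ?f"
  proof (rule integral_dominated_convergence[where w="\<lambda>t. cmod (?f t)"])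
    show "AE t in lborel. (\<lambda>T. indicator {- real T<..<real T} t *\<^sub>R ?f t) \<longlonglongrightarrow> ?f t"
    proof (intro AE_I2 tendsto_eventually)
      fix t :: real
      obtain n where n: "\<bar>t\<bar> < real n" using reals_Archimedean2 by blast
      show "\<forall>\<^sub>F T in sequentially. indicator {- real T<..<real T} t *\<^sub>R ?f t = ?f t"
        using eventually_ge_at_top[of n]
      proof eventually_elim
        case (elim T)
        then have "\<bar>t\<bar> < real T" using n by linarith
        then show ?case by (simp add: indicator_def abs_less_iff)
      qed
    qed
  qed (use f in \<open>auto simp: indicator_def\<close>)
  show ?thesis using LIMSEQ_unique[OF lim2 lim1] .
qed

lemma integral_parabolic_kernel: "integral\<^sup>L lborel parabolic_kernel = 1"
proof -
  interpret real_distribution parabolic_law by (rule real_distribution_parabolic_law)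
  have "measure parabolic_law (- {-1<..1}) = 0"
    by (rule measure_parabolic_law_null) auto
  moreover have "measure parabolic_law (- {-1<..1}) = 1 - measure parabolic_law {-1<..1}"
    using prob_compl[of "{-1<..1}"] by (simp add: Compl_eq_Diff_UNIV)
  ultimately show ?thesis
    using fourier_parabolic_kernel[of 0] by simp
qed

text \<open>Dilation by \<open>c = \<delta> / 2\<close>: the transform at \<open>u\<close> becomes
  the mass of an interval of half-width 1 centred at \<open>- u / c\<close>. If
  \<open>\<bar>u\<bar> \<ge> \<delta>\<close>, the centre is at distance at least 2 from 0, so the
  interval lies where the law has no mass.\<close>

lemma localizing_kernel_real:
  assumes \<delta>: "\<delta> > 0"
  obtains \<Phi> :: "real \<Rightarrow> complex" where "integrable lborel \<Phi>" "integrable lborel (\<lambda>t. complex_of_real t * \<Phi> t)"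
    "integral\<^sup>L lborel \<Phi> = 1" "\<And>u. \<bar>u\<bar> \<ge> \<delta> \<Longrightarrow> (\<integral>t. \<Phi> t * iexp (u * t) \<partial>lborel) = 0"
proof
  define c where "c = \<delta> / 2"
  have c: "c > 0" using \<delta> by (simp add: c_def)
  let ?\<Phi> = "\<lambda>t. complex_of_real c * parabolic_kernel (c * t)"
  show "integrable lborel ?\<Phi>"
    using integrable_lborel_affine[OF integrable_parabolic_kernel, of c 0] c by simp
  show "integrable lborel (\<lambda>t. complex_of_real t * ?\<Phi> t)"
    using integrable_lborel_affine[OF integrable_parabolic_kernel_moment, of c 0] c by (simp add: mult_ac)
  show "integral\<^sup>L lborel ?\<Phi> = 1"
    using integral_lborel_affine[OF measurable_parabolic_kernel, of c 0] c
    by (simp add: integral_parabolic_kernel scaleR_conv_of_real)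
  show "(\<integral>t. ?\<Phi> t * iexp (u * t) \<partial>lborel) = 0" if u: "\<bar>u\<bar> \<ge> \<delta>" for u
  proof -
    have "measure parabolic_law {- (u / c) - 1<..- (u / c) + 1} = 0"
    proof (rule measure_parabolic_law_null)
      have "2 \<le> \<bar>u\<bar> / c" using u c by (simp add: c_def field_simps)
      then have "2 \<le> u / c \<or> u / c \<le> - 2" using c by (auto simp: abs_if split: if_splits)
      then show "x = 1 \<or> \<bar>x\<bar> \<ge> 1" if "x \<in> {- (u / c) - 1<..- (u / c) + 1}" for x
        using that by auto
    qed simp
    then have "0 = (\<integral>s. parabolic_kernel s * iexp (u / c * s) \<partial>lborel)"
      unfolding fourier_parabolic_kernel by simp
    also have "\<dots> = c *\<^sub>R (\<integral>t. parabolic_kernel (c * t) * iexp (u / c * (c * t)) \<partial>lborel)"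
      using c by (subst integral_lborel_affine[where c=c and t=0]) auto
    also have "\<dots> = (\<integral>t. ?\<Phi> t * iexp (u * t) \<partial>lborel)"
      using c by (simp add: scaleR_conv_of_real mult.assoc)
    finally show ?thesis by simp
  qed
qed

text \<open>A tensor power of the one-dimensional kernel, whose transform is the product of the
  coordinate transforms. If \<open>norm u \<ge> \<epsilon>\<close>, some coordinate of
  \<open>u\<close> has modulus at least \<open>\<epsilon> / real DIM('a)\<close>, and the
  corresponding factor vanishes.\<close>

lemma localizing_kernel:
  assumes \<epsilon>: "\<epsilon> > 0"
  obtains \<Phi> :: "'a::euclidean_space \<Rightarrow> complex" where "integrable lborel \<Phi>"
    "integrable lborel (\<lambda>\<eta>. norm \<eta> * cmod (\<Phi> \<eta>))"
    "integral\<^sup>L lborel \<Phi> = 1" "\<And>u. norm u \<ge> \<epsilon> \<Longrightarrow> (\<integral>\<eta>. \<Phi> \<eta> * iexp (u \<bullet> \<eta>) \<partial>lborel) = 0"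
proof -
  obtain \<Psi> :: "real \<Rightarrow> complex" where \<Psi>: "integrable lborel \<Psi>" "integrable lborel (\<lambda>t. complex_of_real t * \<Psi> t)"
    "integral\<^sup>L lborel \<Psi> = 1" "\<And>u. \<bar>u\<bar> \<ge> \<epsilon> / real DIM('a) \<Longrightarrow> (\<integral>t. \<Psi> t * iexp (u * t) \<partial>lborel) = 0"
    using localizing_kernel_real[of "\<epsilon> / real DIM('a)"] \<epsilon> by auto
  define \<Phi> where "\<Phi> \<eta> = (\<Prod>b\<in>Basis. \<Psi> (\<eta> \<bullet> b))" for \<eta> :: 'a
  have [measurable]: "\<Psi> \<in> borel_measurable borel" using borel_measurable_integrable[OF \<Psi>(1)] by simp
  show ?thesis
  proof
    show int: "integrable lborel \<Phi>"
      unfolding \<Phi>_def[abs_def] by (rule integrable_lborel_prod_Basis) (rule \<Psi>)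
    show "integral\<^sup>L lborel \<Phi> = 1"
      unfolding \<Phi>_def[abs_def] by (subst integral_lborel_prod_Basis) (auto simp: \<Psi>)
    show "integrable lborel (\<lambda>\<eta>. norm \<eta> * cmod (\<Phi> \<eta>))"
    proof (rule Bochner_Integration.integrable_bound)
      \<comment> \<open>\<open>norm \<eta>\<close> is at most the sum of the moduli of the
        coordinates. Each resulting term is again a product of one-variable functions, with a first
        moment in the single factor \<open>c\<close>.\<close>
      have int_c: "integrable lborel (\<lambda>\<eta>. \<Prod>b\<in>Basis. if b = c then complex_of_real (\<eta> \<bullet> b) * \<Psi> (\<eta> \<bullet> b) else \<Psi> (\<eta> \<bullet> b))" for c :: 'a
      proof (rule integrable_lborel_prod_Basis[where f="\<lambda>b t. if b = c then complex_of_real t * \<Psi> t else \<Psi> t"])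
        show "integrable lborel (\<lambda>t. if b = c then complex_of_real t * \<Psi> t else \<Psi> t)" for b
          by (cases "b = c") (simp_all add: \<Psi>(1,2))
      qed
      have prod_c: "(\<Prod>b\<in>Basis. if b = c then complex_of_real (\<eta> \<bullet> b) * \<Psi> (\<eta> \<bullet> b) else \<Psi> (\<eta> \<bullet> b)) =
          complex_of_real (\<eta> \<bullet> c) * \<Phi> \<eta>" if "c \<in> Basis" for c \<eta> :: 'a
      proof -
        have "(\<Prod>b\<in>Basis. if b = c then complex_of_real (\<eta> \<bullet> b) * \<Psi> (\<eta> \<bullet> b) else \<Psi> (\<eta> \<bullet> b)) =
           (\<Prod>b\<in>Basis. (if b = c then complex_of_real (\<eta> \<bullet> b) else 1) * \<Psi> (\<eta> \<bullet> b))"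
          by (rule prod.cong) auto
        then show ?thesis using that by (simp add: prod.distrib \<Phi>_def)
      qed
      have "integrable lborel (\<lambda>\<eta>. complex_of_real (\<eta> \<bullet> c) * \<Phi> \<eta>)" if "c \<in> Basis" for c :: 'a
        using int_c[of c] unfolding prod_c[OF that] .
      then show "integrable lborel (\<lambda>\<eta>. \<Sum>c\<in>Basis. cmod (complex_of_real (\<eta> \<bullet> c) * \<Phi> \<eta>))"
        by (intro Bochner_Integration.integrable_sum integrable_norm)
      show "AE \<eta> in lborel. norm (norm \<eta> * cmod (\<Phi> \<eta>)) \<le> norm (\<Sum>c\<in>Basis. cmod (complex_of_real (\<eta> \<bullet> c) * \<Phi> \<eta>))"
        by (intro AE_I2)
           (auto simp: norm_mult sum_distrib_right[symmetric] abs_of_nonneg sum_nonneg intro!: mult_right_mono norm_le_l1)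
    qed (use borel_measurable_integrable[OF int] in auto)
    show "(\<integral>\<eta>. \<Phi> \<eta> * iexp (u \<bullet> \<eta>) \<partial>lborel) = 0" if u: "norm u \<ge> \<epsilon>" for u
    proof -
      have "\<exists>c\<in>Basis. \<bar>u \<bullet> c\<bar> \<ge> \<epsilon> / real DIM('a)"
      proof (rule ccontr)
        assume "\<not> ?thesis"
        then have "(\<Sum>c\<in>Basis. \<bar>u \<bullet> c\<bar>) < (\<Sum>c\<in>(Basis::'a set). \<epsilon> / real DIM('a))"
          by (intro sum_strict_mono) auto
        then show False using u norm_le_l1[of u] by simp
      qed
      then obtain c where c: "c \<in> Basis" "\<bar>u \<bullet> c\<bar> \<ge> \<epsilon> / real DIM('a)" by blast
      have "(\<integral>\<eta>. \<Phi> \<eta> * iexp (u \<bullet> \<eta>) \<partial>lborel) = (\<integral>\<eta>. (\<Prod>b\<in>Basis. \<Psi> (\<eta> \<bullet> b) * iexp ((u \<bullet> b) * (\<eta> \<bullet> b))) \<partial>lborel)"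
        unfolding \<Phi>_def iexp_inner_eq_prod prod.distrib ..
      also have "\<dots> = (\<Prod>b\<in>Basis. \<integral>t. \<Psi> t * iexp ((u \<bullet> b) * t) \<partial>lborel)"
        by (rule integral_lborel_prod_Basis, rule Bochner_Integration.integrable_bound[OF \<Psi>(1)]) (auto simp: norm_mult)
      also have "\<dots> = 0" by (intro prod_zero finite_Basis bexI[OF _ c(1)] \<Psi>(4) c(2))
      finally show ?thesis .
    qed
  qed
qed

section \<open>Variation of the partial integrals between consecutive integers\<close>

lemma L2_fun_borel: "L2_fun g \<Longrightarrow> g \<in> borel_measurable borel"
  by (simp add: L2_fun_def)

lemma integrable_mult_L2:
  assumes "L2_fun g" "L2_fun h"
  shows "integrable lborel (\<lambda>\<xi>. g \<xi> * h \<xi>)"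
proof (rule Bochner_Integration.integrable_bound)
  show "integrable lborel (\<lambda>\<xi>. (cmod (g \<xi>))\<^sup>2 + (cmod (h \<xi>))\<^sup>2)"
    using assms by (auto simp: L2_fun_def)
  have "a * b \<le> a\<^sup>2 + b\<^sup>2" if "0 \<le> a" "0 \<le> b" for a b :: real
    using sum_squares_bound[of a b] mult_nonneg_nonneg[OF that] by linarith
  then show "AE \<xi> in lborel. norm (g \<xi> * h \<xi>) \<le> norm ((cmod (g \<xi>))\<^sup>2 + (cmod (h \<xi>))\<^sup>2)"
    by (intro AE_I2) (simp add: norm_mult)
qed (use assms in \<open>auto simp: L2_fun_def\<close>)

lemma emeasure_shell_finite: "emeasure lborel (shell a b :: 'a::euclidean_space set) < \<infinity>"
  by (rule emeasure_bounded_finite) (auto simp: shell_def bounded_iff intro!: exI[of _ b])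

lemma integrable_indicator_shell: "integrable lborel (indicator (shell a b) :: 'a::euclidean_space \<Rightarrow> real)"
  by (rule integrable_real_indicator) (use emeasure_shell_finite in auto)

lemma L2_fun_indicator_shell: "L2_fun (indicator (shell a b) :: 'a::euclidean_space \<Rightarrow> complex)"
proof -
  have "(\<lambda>\<xi>. (cmod (indicator (shell a b) \<xi>))\<^sup>2) = (indicator (shell a b) :: 'a \<Rightarrow> real)"
    by (auto simp: indicator_def fun_eq_iff)
  then show ?thesis
    by (simp add: L2_fun_def integrable_indicator_shell)
qed

definition shell_sum :: "('a::euclidean_space \<Rightarrow> complex) \<Rightarrow> real \<Rightarrow> real \<Rightarrow> 'a \<Rightarrow> complex" where
  "shell_sum g a b x = (\<integral>\<xi>. indicator (shell a b) \<xi> * g \<xi> * iexp (x \<bullet> \<xi>) \<partial>lborel)"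

lemma measurable_shell_sum [measurable]:
  "g \<in> borel_measurable borel \<Longrightarrow> shell_sum g a b \<in> borel_measurable borel"
  unfolding shell_sum_def[abs_def] by (rule measurable_fourier_integral) measurable

lemma integrable_shell_L2:
  "L2_fun g \<Longrightarrow> integrable lborel (\<lambda>\<xi>. indicator (shell a b) \<xi> * g \<xi>)"
  by (rule integrable_mult_L2[OF L2_fun_indicator_shell])

lemma shell_sum_add:
  assumes "L2_fun g" "a \<le> b" "b \<le> c"
  shows "shell_sum g a c x = shell_sum g a b x + shell_sum g b c x"
proof -
  have "shell_sum g a c x = (\<integral>\<xi>. indicator (shell a b) \<xi> * g \<xi> * iexp (x \<bullet> \<xi>) +
      indicator (shell b c) \<xi> * g \<xi> * iexp (x \<bullet> \<xi>) \<partial>lborel)"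
    unfolding shell_sum_def using assms
    by (intro Bochner_Integration.integral_cong) (auto simp: indicator_def shell_def)
  also have "\<dots> = shell_sum g a b x + shell_sum g b c x"
    unfolding shell_sum_def
    by (intro Bochner_Integration.integral_add integrable_mult_iexp integrable_shell_L2 assms(1))
  finally show ?thesis .
qed

lemma shell_sum_self: "shell_sum g a a x = 0" for x :: "'a::euclidean_space"
proof -
  have "shell a a = ({} :: 'a set)" by (auto simp: shell_def)
  then show ?thesis by (simp add: shell_sum_def)
qed

lemma shell_sum_partition:
  assumes g: "L2_fun g" and h: "0 \<le> h"
  shows "shell_sum g a (a + real m * h) x = (\<Sum>i<m. shell_sum g (a + real i * h) (a + real (Suc i) * h) x)"
proof (induction m)
  case 0
  then show ?case by (simp add: shell_sum_self)
next
  case (Suc m)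
  have "shell_sum g a (a + real (Suc m) * h) x
      = shell_sum g a (a + real m * h) x + shell_sum g (a + real m * h) (a + real (Suc m) * h) x"
    using h by (intro shell_sum_add[OF g]) (auto intro: mult_right_mono)
  then show ?case using Suc by simp
qed

text \<open>When the outer radius increases to its limit, each indicator is eventually constant in
  \<open>n\<close> because shells are open at the outer radius. This carries bounds from dyadic
  radii to all radii.\<close>

lemma shell_sum_left_continuous:
  assumes g: "L2_fun g" and r: "r \<longlonglongrightarrow> R" "\<And>n. r n \<le> R"
  shows "(\<lambda>n. shell_sum g a (r n) x) \<longlonglongrightarrow> shell_sum g a R x"
  unfolding shell_sum_def
proof (rule integral_dominated_convergence[where w="\<lambda>\<xi>. cmod (indicator (shell a R) \<xi> * g \<xi>)"])
  have [measurable]: "g \<in> borel_measurable borel" using g by (rule L2_fun_borel)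
  show "(\<lambda>\<xi>. indicator (shell a R) \<xi> * g \<xi> * iexp (x \<bullet> \<xi>)) \<in> borel_measurable lborel"
    "\<And>n. (\<lambda>\<xi>. indicator (shell a (r n)) \<xi> * g \<xi> * iexp (x \<bullet> \<xi>)) \<in> borel_measurable lborel"
    by measurable
  show "integrable lborel (\<lambda>\<xi>. cmod (indicator (shell a R) \<xi> * g \<xi>))"
    by (intro integrable_norm integrable_shell_L2 g)
  show "AE \<xi> in lborel. norm (indicator (shell a (r n)) \<xi> * g \<xi> * iexp (x \<bullet> \<xi>))
      \<le> cmod (indicator (shell a R) \<xi> * g \<xi>)" for n
    using r(2)[of n] by (intro AE_I2) (auto simp: norm_mult indicator_def shell_def)
  show "AE \<xi> in lborel. (\<lambda>n. indicator (shell a (r n)) \<xi> * g \<xi> * iexp (x \<bullet> \<xi>))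
      \<longlonglongrightarrow> indicator (shell a R) \<xi> * g \<xi> * iexp (x \<bullet> \<xi>)"
  proof (intro AE_I2 tendsto_eventually)
    fix \<xi> :: 'a
    show "\<forall>\<^sub>F n in sequentially. indicator (shell a (r n)) \<xi> * g \<xi> * iexp (x \<bullet> \<xi>) =
        indicator (shell a R) \<xi> * g \<xi> * iexp (x \<bullet> \<xi>)"
    proof (cases "norm \<xi> < R")
      case True
      from order_tendstoD(1)[OF r(1) this] show ?thesis
        by eventually_elim (use True in \<open>auto simp: indicator_def shell_def\<close>)
    next
      case False
      have "\<not> norm \<xi> < r n" for n using False r(2)[of n] by simp
      then show ?thesis using False by (auto simp: indicator_def shell_def)
    qed
  qed
qed

text \<open>Tonelli: the sum over \<open>k\<close> has finite integral, hence is finite almost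
  everywhere, and the terms of a convergent series tend to 0. It is applied at integer radii and to
  the oscillation between them.\<close>

lemma AE_tendsto_0_if_nn_integral_summable:
  fixes u :: "nat \<Rightarrow> 'a \<Rightarrow> ennreal"
  assumes [measurable]: "\<And>k. u k \<in> borel_measurable M"
    and fin: "(\<Sum>k. integral\<^sup>N M (u k)) < \<infinity>"
  shows "AE x in M. (\<lambda>k. u k x) \<longlonglongrightarrow> 0"
proof -
  have "integral\<^sup>N M (\<lambda>x. \<Sum>k. u k x) = (\<Sum>k. integral\<^sup>N M (u k))"
    by (rule nn_integral_suminf) measurable
  then have "integral\<^sup>N M (\<lambda>x. \<Sum>k. u k x) \<noteq> \<infinity>" using fin by simp
  then have "AE x in M. (\<Sum>k. u k x) \<noteq> \<infinity>"
    by (intro nn_integral_PInf_AE) auto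
  then show ?thesis
  proof eventually_elim
    fix x assume s: "(\<Sum>k. u k x) \<noteq> \<infinity>"
    have "u k x \<le> (\<Sum>k. u k x)" for k
      using sum_le_suminf[of "\<lambda>k. u k x" "{k}"] by simp
    then have "u k x \<noteq> top" for k using s top.extremum_unique by (metis infinity_ennreal_def)
    then have eq: "u k x = ennreal (enn2real (u k x))" for k by (simp add: top.not_eq_extremum)
    have "summable (\<lambda>k. enn2real (u k x))"
      using s by (intro summable_suminf_not_top) (simp_all add: eq[symmetric])
    then have "(\<lambda>k. ennreal (enn2real (u k x))) \<longlonglongrightarrow> ennreal 0"
      by (intro tendsto_ennrealI summable_LIMSEQ_zero)
    then show "(\<lambda>k. u k x) \<longlonglongrightarrow> 0" by (simp add: eq[symmetric])
  qed
qed

text \<open>Dyadic partitions are nested, so by the triangle inequality this grows with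
  \<open>n\<close>, and its supremum over \<open>n\<close> can be integrated by monotone
  convergence. That supremum controls the partial integrals from \<open>k\<close> up to every radius
  in \<open>[k, k + 1]\<close>.\<close>

definition dyadic_variation :: "('a::euclidean_space \<Rightarrow> complex) \<Rightarrow> real \<Rightarrow> nat \<Rightarrow> 'a \<Rightarrow> real" where
  "dyadic_variation g k n x =
     (\<Sum>i<2 ^ n. cmod (shell_sum g (k + real i * (1 / 2 ^ n)) (k + real (Suc i) * (1 / 2 ^ n)) x))"

lemma measurable_dyadic_variation [measurable]:
  "g \<in> borel_measurable borel \<Longrightarrow> dyadic_variation g k n \<in> borel_measurable borel"
  unfolding dyadic_variation_def[abs_def] by measurable

lemma dyadic_variation_nonneg: "0 \<le> dyadic_variation g k n x"
  by (simp add: dyadic_variation_def sum_nonneg)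

lemma sum_lessThan_double: "(\<Sum>i<2 * m. f i) = (\<Sum>i<m. f (2 * i) + f (Suc (2 * i)))"
  for f :: "nat \<Rightarrow> 'a::comm_monoid_add"
  by (induction m) (simp_all add: add.assoc)

lemma dyadic_variation_Suc:
  assumes g: "L2_fun g"
  shows "dyadic_variation g k n x \<le> dyadic_variation g k (Suc n) x"
proof -
  let ?h = "1 / 2 ^ Suc n :: real"
  have "cmod (shell_sum g (k + real i * (1 / 2 ^ n)) (k + real (Suc i) * (1 / 2 ^ n)) x)
    \<le> cmod (shell_sum g (k + real (2 * i) * ?h) (k + real (Suc (2 * i)) * ?h) x) +
      cmod (shell_sum g (k + real (Suc (2 * i)) * ?h) (k + real (Suc (Suc (2 * i))) * ?h) x)" for i
  proof -
    have "k + real i * (1 / 2 ^ n) = k + real (2 * i) * ?h" "k + real (Suc i) * (1 / 2 ^ n) = k + real (Suc (Suc (2 * i))) * ?h"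
      by (simp_all add: field_simps)
    moreover have "shell_sum g (k + real (2 * i) * ?h) (k + real (Suc (Suc (2 * i))) * ?h) x =
        shell_sum g (k + real (2 * i) * ?h) (k + real (Suc (2 * i)) * ?h) x +
        shell_sum g (k + real (Suc (2 * i)) * ?h) (k + real (Suc (Suc (2 * i))) * ?h) x"
      by (intro shell_sum_add[OF g] add_left_mono mult_right_mono) auto
    ultimately show ?thesis using norm_triangle_ineq by metis
  qed
  then show ?thesis
    unfolding dyadic_variation_def power_Suc sum_lessThan_double by (intro sum_mono)
qed

lemma shell_sum_le_dyadic_variation:
  assumes g: "L2_fun g" and m: "m \<le> 2 ^ n"
  shows "cmod (shell_sum g k (k + real m * (1 / 2 ^ n)) x) \<le> dyadic_variation g k n x"
proof -
  have "cmod (shell_sum g k (k + real m * (1 / 2 ^ n)) x)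
      \<le> (\<Sum>i<m. cmod (shell_sum g (k + real i * (1 / 2 ^ n)) (k + real (Suc i) * (1 / 2 ^ n)) x))"
    by (subst shell_sum_partition[OF g]) (auto intro: norm_sum)
  also have "\<dots> \<le> dyadic_variation g k n x"
    unfolding dyadic_variation_def using m by (intro sum_mono2) auto
  finally show ?thesis .
qed

text \<open>The radius \<open>R\<close> is approached from below by grid radii, where the triangle
  inequality bounds the partial integral by the variation; left continuity passes to the limit. The
  weighted square is the form in which the supremum is integrated later.\<close>

lemma shell_sum_le_SUP_dyadic_variation:
  assumes g: "L2_fun g" and R: "k \<le> R" "R \<le> k + 1" and c: "0 \<le> c"
  shows "ennreal (c * (cmod (shell_sum g k R x))\<^sup>2) \<le> (SUP n. ennreal (c * (dyadic_variation g k n x)\<^sup>2))"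
proof -
  \<comment> \<open>The number of grid shells of thickness \<open>1 / 2 ^ n\<close> that fit between
    \<open>k\<close> and \<open>R\<close>, so \<open>r n\<close> is \<open>R\<close> rounded down to
    the grid.\<close>
  define m where "m n = nat \<lfloor>(R - k) * 2 ^ n\<rfloor>" for n
  define r where "r n = k + real (m n) * (1 / 2 ^ n)" for n
  have rm: "real (m n) = of_int \<lfloor>(R - k) * 2 ^ n\<rfloor>" for n
    using R by (simp add: m_def)
  have rR: "r n \<le> R" for n
  proof -
    have "real (m n) \<le> (R - k) * 2 ^ n" unfolding rm by (rule of_int_floor_le)
    then show ?thesis by (simp add: r_def field_simps)
  qed
  have Rr: "R - 1 / 2 ^ n \<le> r n" for n
  proof -
    have "(R - k) * 2 ^ n \<le> real (m n) + 1" unfolding rm by linarith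
    then have "(R - k) \<le> (real (m n) + 1) / 2 ^ n" by (simp add: field_simps)
    then show ?thesis by (simp add: r_def add_divide_distrib)
  qed
  have m2: "m n \<le> 2 ^ n" for n
  proof -
    have "real (m n) \<le> (R - k) * 2 ^ n" unfolding rm by (rule of_int_floor_le)
    also have "\<dots> \<le> 1 * 2 ^ n" using R by (intro mult_right_mono) auto
    finally show ?thesis by (metis mult_1 of_nat_le_iff of_nat_numeral of_nat_power)
  qed
  have "(\<lambda>n. 1 / 2 ^ n :: real) \<longlonglongrightarrow> 0"
    using LIMSEQ_realpow_zero[of "1 / 2"] by (simp add: power_one_over)
  then have "(\<lambda>n. R - 1 / 2 ^ n) \<longlonglongrightarrow> R - 0" by (intro tendsto_intros)
  then have "r \<longlonglongrightarrow> R"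
    by (intro tendsto_sandwich[of "\<lambda>n. R - 1 / 2 ^ n" r sequentially "\<lambda>_. R"]) (auto simp: rR Rr)
  then have "(\<lambda>n. shell_sum g k (r n) x) \<longlonglongrightarrow> shell_sum g k R x"
    using rR by (rule shell_sum_left_continuous[OF g])
  then have "(\<lambda>n. ennreal (c * (cmod (shell_sum g k (r n) x))\<^sup>2)) \<longlonglongrightarrow> ennreal (c * (cmod (shell_sum g k R x))\<^sup>2)"
    by (intro tendsto_intros)
  then show ?thesis
  proof (rule LIMSEQ_le_const2, intro exI[of _ 0] allI impI)
    fix n
    have "cmod (shell_sum g k (r n) x) \<le> dyadic_variation g k n x"
      unfolding r_def by (rule shell_sum_le_dyadic_variation[OF g m2])
    then have "ennreal (c * (cmod (shell_sum g k (r n) x))\<^sup>2) \<le> ennreal (c * (dyadic_variation g k n x)\<^sup>2)"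
      using c by (intro ennreal_leI mult_left_mono power_mono) auto
    also have "\<dots> \<le> (SUP n. ennreal (c * (dyadic_variation g k n x)\<^sup>2))" by (rule SUP_upper) simp
    finally show "ennreal (c * (cmod (shell_sum g k (r n) x))\<^sup>2) \<le> (SUP n. ennreal (c * (dyadic_variation g k n x)\<^sup>2))" .
  qed
qed

lemma sum_indicator_shell:
  assumes "0 \<le> h"
  shows "(\<Sum>i<m. indicator (shell (a + real i * h) (a + real (Suc i) * h)) \<xi>) = (indicator (shell a (a + real m * h)) \<xi> :: ennreal)"
proof (induction m)
  case 0
  then show ?case by (simp add: shell_def)
next
  case (Suc m)
  define y where "y = real m * h"
  have y: "0 \<le> y" "real (Suc m) * h = y + h" using assms by (simp_all add: y_def distrib_right)
  have "indicator (shell a (a + real m * h)) \<xi> + indicator (shell (a + real m * h) (a + real (Suc m) * h)) \<xi>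
      = (indicator (shell a (a + real (Suc m) * h)) \<xi> :: ennreal)"
    unfolding y(2) y_def[symmetric] using assms y(1) by (auto simp: indicator_def shell_def)
  then show ?case using Suc by simp
qed

text \<open>\<open>gaussian_weighted_fourier_bound\<close> with the shell as the set
  \<open>A\<close>; the factor \<open>b - a\<close> comes from the Gaussian mass of the
  shell.\<close>

lemma shell_sum_weighted_bound:
  "\<exists>C\<ge>0. \<forall>(g :: 'a::euclidean_space \<Rightarrow> complex) a b. L2_fun g \<longrightarrow> 1 \<le> a \<longrightarrow> a \<le> b \<longrightarrow> b \<le> a + 1 \<longrightarrow>
     (\<integral>\<^sup>+x. ennreal (exp (- (norm x)\<^sup>2 / 2) * (cmod (shell_sum g a b x))\<^sup>2) \<partial>lborel)
       \<le> ennreal (C * (b - a)) * (\<integral>\<^sup>+\<xi>. indicator (shell a b) \<xi> * ennreal ((cmod (g \<xi>))\<^sup>2) \<partial>lborel)"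
proof -
  obtain C where C: "C \<ge> 0" "\<And>a b (\<xi>::'a). 1 \<le> a \<Longrightarrow> a \<le> b \<Longrightarrow> b \<le> a + 1 \<Longrightarrow>
     (\<integral>\<^sup>+\<eta>. indicator (shell a b) \<eta> * ennreal (exp (- (norm (\<xi> - \<eta>))\<^sup>2 / 2)) \<partial>lborel) \<le> ennreal (C * (b - a))"
    using gaussian_shell_bound[where 'a='a] by blast
  let ?K = "sqrt (2 * pi) ^ DIM('a)"
  have "(\<integral>\<^sup>+x. ennreal (exp (- (norm x)\<^sup>2 / 2) * (cmod (shell_sum g a b x))\<^sup>2) \<partial>lborel)
       \<le> ennreal ((?K * C) * (b - a)) * (\<integral>\<^sup>+\<xi>. indicator (shell a b) \<xi> * ennreal ((cmod (g \<xi>))\<^sup>2) \<partial>lborel)"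
    if g: "L2_fun g" and ab: "1 \<le> a" "a \<le> b" "b \<le> a + 1" for g :: "'a \<Rightarrow> complex" and a b
  proof -
    let ?h = "\<lambda>\<xi>. indicator (shell a b) \<xi> * g \<xi>"
    have "(\<integral>\<^sup>+x. ennreal (exp (- (norm x)\<^sup>2 / 2) * (cmod (shell_sum g a b x))\<^sup>2) \<partial>lborel)
       \<le> ennreal ?K * (ennreal (C * (b - a)) * (\<integral>\<^sup>+\<xi>. ennreal ((cmod (?h \<xi>))\<^sup>2) \<partial>lborel))"
      unfolding shell_sum_def
      by (rule gaussian_weighted_fourier_bound[where A="shell a b"]) (use integrable_shell_L2[OF g] C(2)[OF ab] in auto)
    also have "(\<integral>\<^sup>+\<xi>. ennreal ((cmod (?h \<xi>))\<^sup>2) \<partial>lborel) = (\<integral>\<^sup>+\<xi>. indicator (shell a b) \<xi> * ennreal ((cmod (g \<xi>))\<^sup>2) \<partial>lborel)"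
      by (intro nn_integral_cong) (auto simp: indicator_def)
    also have "ennreal ?K * (ennreal (C * (b - a)) * (\<integral>\<^sup>+\<xi>. indicator (shell a b) \<xi> * ennreal ((cmod (g \<xi>))\<^sup>2) \<partial>lborel))
       = ennreal ((?K * C) * (b - a)) * (\<integral>\<^sup>+\<xi>. indicator (shell a b) \<xi> * ennreal ((cmod (g \<xi>))\<^sup>2) \<partial>lborel)"
      using C(1) ab by (simp add: mult.assoc[symmetric] ennreal_mult[symmetric])
    finally show ?thesis .
  qed
  then show ?thesis using C(1) by (intro exI[of _ "?K * C"]) auto
qed

text \<open>Cauchy--Schwarz over the \<open>2\<^sup>n\<close> thin shells loses a factor \<open>2\<^sup>n\<close>, which the thickness
  \<open>2\<^sup>-\<^sup>n\<close> in the bound for each shell gives back.\<close>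

lemma dyadic_variation_weighted_bound:
  "\<exists>C\<ge>0. \<forall>(g :: 'a::euclidean_space \<Rightarrow> complex) k n. L2_fun g \<longrightarrow> 1 \<le> k \<longrightarrow>
     (\<integral>\<^sup>+x. ennreal (exp (- (norm x)\<^sup>2 / 2) * (dyadic_variation g k n x)\<^sup>2) \<partial>lborel)
       \<le> ennreal C * (\<integral>\<^sup>+\<xi>. indicator (shell k (k + 1)) \<xi> * ennreal ((cmod (g \<xi>))\<^sup>2) \<partial>lborel)"
proof -
  let ?w = "\<lambda>x::'a. exp (- (norm x)\<^sup>2 / 2)"
  obtain C where C: "C \<ge> 0" "\<And>(g :: 'a \<Rightarrow> complex) a b. L2_fun g \<Longrightarrow> 1 \<le> a \<Longrightarrow> a \<le> b \<Longrightarrow> b \<le> a + 1 \<Longrightarrow>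
     (\<integral>\<^sup>+x. ennreal (?w x * (cmod (shell_sum g a b x))\<^sup>2) \<partial>lborel)
       \<le> ennreal (C * (b - a)) * (\<integral>\<^sup>+\<xi>. indicator (shell a b) \<xi> * ennreal ((cmod (g \<xi>))\<^sup>2) \<partial>lborel)"
    using shell_sum_weighted_bound[where 'a='a] by blast
  have "(\<integral>\<^sup>+x. ennreal (?w x * (dyadic_variation g k n x)\<^sup>2) \<partial>lborel)
       \<le> ennreal C * (\<integral>\<^sup>+\<xi>. indicator (shell k (k + 1)) \<xi> * ennreal ((cmod (g \<xi>))\<^sup>2) \<partial>lborel)"
    if g: "L2_fun g" and k: "1 \<le> k" for g :: "'a \<Rightarrow> complex" and k n
  proof -
    have [measurable]: "g \<in> borel_measurable borel" using g by (rule L2_fun_borel)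
    define h where "h = (1 / 2 ^ n :: real)"
    have h: "0 \<le> h" "h \<le> 1" "2 ^ n * h = 1" by (auto simp: h_def)
    let ?a = "\<lambda>i. k + real i * h" and ?b = "\<lambda>i. k + real (Suc i) * h"
    let ?S = "\<lambda>i x. cmod (shell_sum g (?a i) (?b i) x)"
    let ?G = "\<lambda>\<xi>. ennreal ((cmod (g \<xi>))\<^sup>2)"
    have "?w x * (dyadic_variation g k n x)\<^sup>2 \<le> 2 ^ n * (\<Sum>i<2 ^ n. ?w x * (?S i x)\<^sup>2)" for x
    proof -
      have "(dyadic_variation g k n x)\<^sup>2 \<le> (\<Sum>i<2 ^ n. (?S i x)\<^sup>2) * 2 ^ n"
        using sum_squared_le_sum_of_squares[of "\<lambda>i. ?S i x" "{..<2 ^ n}"] by (simp add: dyadic_variation_def h_def)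
      then have "?w x * (dyadic_variation g k n x)\<^sup>2 \<le> ?w x * ((\<Sum>i<2 ^ n. (?S i x)\<^sup>2) * 2 ^ n)"
        by (intro mult_left_mono) auto
      then show ?thesis by (simp only: sum_distrib_left[symmetric] mult_ac)
    qed
    then have "(\<integral>\<^sup>+x. ennreal (?w x * (dyadic_variation g k n x)\<^sup>2) \<partial>lborel)
        \<le> (\<integral>\<^sup>+x. ennreal (2 ^ n * (\<Sum>i<2 ^ n. ?w x * (?S i x)\<^sup>2)) \<partial>lborel)"
      by (intro nn_integral_mono ennreal_leI)
    also have "\<dots> = (\<integral>\<^sup>+x. ennreal (2 ^ n) * (\<Sum>i<2 ^ n. ennreal (?w x * (?S i x)\<^sup>2)) \<partial>lborel)"
      by (intro nn_integral_cong, subst ennreal_mult, simp, simp add: sum_nonneg, subst sum_ennreal[symmetric]) simp_all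
    also have "\<dots> = ennreal (2 ^ n) * (\<Sum>i<2 ^ n. \<integral>\<^sup>+x. ennreal (?w x * (?S i x)\<^sup>2) \<partial>lborel)"
      by (subst nn_integral_cmult, measurable, subst nn_integral_sum) auto
    also have "\<dots> \<le> ennreal (2 ^ n) * (\<Sum>i<2 ^ n. ennreal (C * h) * (\<integral>\<^sup>+\<xi>. indicator (shell (?a i) (?b i)) \<xi> * ?G \<xi> \<partial>lborel))"
    proof (intro mult_left_mono sum_mono)
      fix i :: nat
      have ba: "?b i - ?a i = h" by (simp add: algebra_simps)
      have "1 \<le> ?a i" "?a i \<le> ?b i" "?b i \<le> ?a i + 1"
        using k h by (auto simp: distrib_right intro: add_increasing2)
      from C(2)[OF g this] show "(\<integral>\<^sup>+x. ennreal (?w x * (?S i x)\<^sup>2) \<partial>lborel) \<le> ennreal (C * h) * (\<integral>\<^sup>+\<xi>. indicator (shell (?a i) (?b i)) \<xi> * ?G \<xi> \<partial>lborel)"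
        unfolding ba .
    qed simp
    also have "\<dots> = ennreal (2 ^ n) * (ennreal (C * h) * (\<integral>\<^sup>+\<xi>. (\<Sum>i<2 ^ n. indicator (shell (?a i) (?b i)) \<xi> * ?G \<xi>) \<partial>lborel))"
      by (subst nn_integral_sum) (auto simp: sum_distrib_left)
    also have "(\<lambda>\<xi>. \<Sum>i<2 ^ n. indicator (shell (?a i) (?b i)) \<xi> * ?G \<xi>) = (\<lambda>\<xi>. indicator (shell k (k + 1)) \<xi> * ?G \<xi>)"
      unfolding sum_distrib_right[symmetric] sum_indicator_shell[OF h(1)] using h(3) by simp
    also have "ennreal (2 ^ n) * (ennreal (C * h) * (\<integral>\<^sup>+\<xi>. indicator (shell k (k + 1)) \<xi> * ?G \<xi> \<partial>lborel))
        = ennreal (2 ^ n * (C * h)) * (\<integral>\<^sup>+\<xi>. indicator (shell k (k + 1)) \<xi> * ?G \<xi> \<partial>lborel)"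
      using C(1) h by (subst ennreal_mult) (auto simp: mult.assoc)
    also have "2 ^ n * (C * h) = C" using h(3) by (simp add: mult.left_commute)
    finally show ?thesis .
  qed
  then show ?thesis using C(1) by blast
qed

text \<open>The bound on each unit shell is uniform in \<open>n\<close>, so monotone convergence
  gives it for the supremum. The unit shells are disjoint, hence these bounds sum to at most a
  multiple of the squared norm of \<open>g\<close>. Radii start at 1, as the shell estimate
  requires.\<close>

lemma AE_dyadic_variation_tendsto_0:
  fixes g :: "'a::euclidean_space \<Rightarrow> complex"
  assumes g: "L2_fun g"
  shows "AE x in lborel. (\<lambda>k. SUP n. ennreal (exp (- (norm x)\<^sup>2 / 2) * (dyadic_variation g (1 + real k) n x)\<^sup>2)) \<longlonglongrightarrow> 0"
proof (rule AE_tendsto_0_if_nn_integral_summable)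
  let ?w = "\<lambda>x::'a. exp (- (norm x)\<^sup>2 / 2)" and ?G = "\<lambda>\<xi>. ennreal ((cmod (g \<xi>))\<^sup>2)"
  have [measurable]: "g \<in> borel_measurable borel" using g by (rule L2_fun_borel)
  show "(\<lambda>x. SUP n. ennreal (?w x * (dyadic_variation g (1 + real k) n x)\<^sup>2)) \<in> borel_measurable lborel" for k
    by measurable
  obtain C where C: "C \<ge> 0" "\<And>k n. 1 \<le> k \<Longrightarrow>
     (\<integral>\<^sup>+x. ennreal (?w x * (dyadic_variation g k n x)\<^sup>2) \<partial>lborel)
       \<le> ennreal C * (\<integral>\<^sup>+\<xi>. indicator (shell k (k + 1)) \<xi> * ?G \<xi> \<partial>lborel)"
    using dyadic_variation_weighted_bound[where 'a='a] g by blast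
  have le: "(\<integral>\<^sup>+x. (SUP n. ennreal (?w x * (dyadic_variation g (1 + real k) n x)\<^sup>2)) \<partial>lborel)
     \<le> ennreal C * (\<integral>\<^sup>+\<xi>. indicator (shell (1 + real k) (1 + real k + 1)) \<xi> * ?G \<xi> \<partial>lborel)" for k
  proof (subst nn_integral_monotone_convergence_SUP)
    show "incseq (\<lambda>n x. ennreal (?w x * (dyadic_variation g (1 + real k) n x)\<^sup>2))"
      by (intro incseq_SucI le_funI ennreal_leI mult_left_mono power_mono dyadic_variation_Suc[OF g] dyadic_variation_nonneg) auto
    show "(SUP n. \<integral>\<^sup>+x. ennreal (?w x * (dyadic_variation g (1 + real k) n x)\<^sup>2) \<partial>lborel)
     \<le> ennreal C * (\<integral>\<^sup>+\<xi>. indicator (shell (1 + real k) (1 + real k + 1)) \<xi> * ?G \<xi> \<partial>lborel)"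
      by (intro SUP_least C(2)) simp
  qed measurable
  have "(\<Sum>k. \<integral>\<^sup>+x. (SUP n. ennreal (?w x * (dyadic_variation g (1 + real k) n x)\<^sup>2)) \<partial>lborel)
     \<le> (\<Sum>k. ennreal C * (\<integral>\<^sup>+\<xi>. indicator (shell (1 + real k) (1 + real k + 1)) \<xi> * ?G \<xi> \<partial>lborel))"
    by (intro suminf_le le summableI)
  also have "\<dots> = ennreal C * (\<integral>\<^sup>+\<xi>. (\<Sum>k. indicator (shell (1 + real k) (1 + real k + 1)) \<xi> * ?G \<xi>) \<partial>lborel)"
    by (subst nn_integral_suminf) auto
  also have "\<dots> \<le> ennreal C * (\<integral>\<^sup>+\<xi>. ?G \<xi> \<partial>lborel)"
  proof (intro mult_left_mono nn_integral_mono suminf_le_const summableI)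
    fix \<xi> :: 'a and n
    have "(\<Sum>k<n. indicator (shell (1 + real k) (1 + real k + 1)) \<xi> * ?G \<xi>) = indicator (shell 1 (1 + real n)) \<xi> * ?G \<xi>"
      using sum_indicator_shell[of 1 1 \<xi> n] by (simp add: sum_distrib_right[symmetric] add_ac)
    then show "(\<Sum>k<n. indicator (shell (1 + real k) (1 + real k + 1)) \<xi> * ?G \<xi>) \<le> ?G \<xi>"
      by (simp add: indicator_def)
  qed simp
  also have "\<dots> < \<infinity>"
    using g by (simp add: L2_fun_def nn_integral_eq_integral ennreal_mult_less_top)
  finally show "(\<Sum>k. \<integral>\<^sup>+x. (SUP n. ennreal (?w x * (dyadic_variation g (1 + real k) n x)\<^sup>2)) \<partial>lborel) < \<infinity>" .
qed

section \<open>Localization at integer radii\<close>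

lemma L2_fun_bounded_integrable:
  fixes u :: "'a::euclidean_space \<Rightarrow> complex"
  assumes u: "integrable lborel u" and L: "\<And>\<xi>. cmod (u \<xi>) \<le> L"
  shows "L2_fun u"
  unfolding L2_fun_def
proof
  show m: "u \<in> borel_measurable lborel" by (rule borel_measurable_integrable[OF u])
  show "integrable lborel (\<lambda>\<xi>. (cmod (u \<xi>))\<^sup>2)"
  proof (rule Bochner_Integration.integrable_bound)
    show "integrable lborel (\<lambda>\<xi>. L * cmod (u \<xi>))" using u by simp
    show "AE \<xi> in lborel. norm ((cmod (u \<xi>))\<^sup>2) \<le> norm (L * cmod (u \<xi>))"
    proof (intro AE_I2)
      fix \<xi>
      have "cmod (u \<xi>) * cmod (u \<xi>) \<le> L * cmod (u \<xi>)" by (intro mult_right_mono L) simp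
      then show "norm ((cmod (u \<xi>))\<^sup>2) \<le> norm (L * cmod (u \<xi>))" by (simp add: power2_eq_square)
    qed
  qed (use m in measurable)
qed

text \<open>Parseval's formula drawn from the limit that characterises \<open>g\<close>: Fubini
  moves the transform from the truncated \<open>f\<close> to \<open>k\<close>, where
  \<open>vanish\<close> makes the pairing 0 for every \<open>R\<close>, and mean-square convergence
  passes to \<open>g\<close>.\<close>

lemma L2_fourier_pairing_eq_0:
  fixes f g k :: "'a::euclidean_space \<Rightarrow> complex"
  assumes f: "L2_fun f" and fg: "is_L2_fourier f g"
    and k: "integrable lborel k" "L2_fun k"
    and vanish: "AE y in lborel. f y * (\<integral>\<zeta>. k \<zeta> * exp (- \<i> * complex_of_real (y \<bullet> \<zeta>)) \<partial>lborel) = 0"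
  shows "(\<integral>\<zeta>. k \<zeta> * g \<zeta> \<partial>lborel) = 0"
proof -
  let ?c = "complex_of_real ((2 * pi) powr (- real DIM('a) / 2))"
  let ?E = "\<lambda>\<zeta> y::'a. exp (- \<i> * complex_of_real (y \<bullet> \<zeta>))"
  have g: "L2_fun g" using fg by (simp add: is_L2_fourier_def)
  have [measurable]: "f \<in> borel_measurable borel" "g \<in> borel_measurable borel" "k \<in> borel_measurable borel"
    using f g k(2) by (auto dest: L2_fun_borel)
  have kg: "integrable lborel (\<lambda>\<zeta>. k \<zeta> * g \<zeta>)" by (rule integrable_mult_L2[OF k(2) g])
  define T where "T R = fourier_trunc f R" for R
  \<comment> \<open>Truncation to a ball makes \<open>f\<close> integrable and not only square
    integrable, so that Fubini applies.\<close>
  define fR where "fR R y = indicator (shell 0 R) y * f y" for R and y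
  have fR: "integrable lborel (fR R)" for R
    unfolding fR_def[abs_def] by (rule integrable_shell_L2[OF f])
  have [measurable]: "fR R \<in> borel_measurable borel" for R
    unfolding fR_def[abs_def] by measurable
  have T_eq: "T R \<zeta> = ?c * (\<integral>y. fR R y * ?E \<zeta> y \<partial>lborel)" for R \<zeta>
    unfolding T_def fourier_trunc_def set_lebesgue_integral_def fR_def
    by (intro arg_cong2[where f="(*)"] refl Bochner_Integration.integral_cong)
       (auto simp: indicator_def shell_def)
  have Em: "(\<lambda>(\<zeta>, y). ?E \<zeta> y) \<in> borel_measurable borel"
    by (intro borel_measurable_continuous_onI) (auto simp: case_prod_beta' intro!: continuous_intros)
  have E1: "cmod (?E \<zeta> y) \<le> 1" for \<zeta> y by simp
  have Tm[measurable]: "T R \<in> borel_measurable borel" for R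
    unfolding T_eq[abs_def] by measurable
  have Tb: "cmod (T R \<zeta>) \<le> cmod ?c * (\<integral>y. cmod (fR R y) \<partial>lborel)" for R \<zeta>
  proof -
    have "cmod (\<integral>y. fR R y * ?E \<zeta> y \<partial>lborel) \<le> (\<integral>y. cmod (fR R y) \<partial>lborel)"
      using integral_norm_bound[of lborel "\<lambda>y. fR R y * ?E \<zeta> y"] by (simp add: norm_mult)
    then show ?thesis unfolding T_eq norm_mult by (intro mult_left_mono) auto
  qed
  have kT: "integrable lborel (\<lambda>\<zeta>. k \<zeta> * T R \<zeta>)" for R
  proof (rule Bochner_Integration.integrable_bound)
    show "integrable lborel (\<lambda>\<zeta>. complex_of_real (cmod ?c * (\<integral>y. cmod (fR R y) \<partial>lborel)) * k \<zeta>)"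
      using k(1) by simp
    have "cmod (k \<zeta> * T R \<zeta>) \<le> cmod (complex_of_real (cmod ?c * (\<integral>y. cmod (fR R y) \<partial>lborel)) * k \<zeta>)" for \<zeta>
      unfolding norm_mult norm_of_real abs_mult
      using mult_left_mono[OF Tb[where R=R and \<zeta>=\<zeta>], of "cmod (k \<zeta>)"] by (simp add: mult_ac)
    then show "AE \<zeta> in lborel. norm (k \<zeta> * T R \<zeta>) \<le> norm (complex_of_real (cmod ?c * (\<integral>y. cmod (fR R y) \<partial>lborel)) * k \<zeta>)"
      by simp
  qed measurable
  have kT0: "(\<integral>\<zeta>. k \<zeta> * T R \<zeta> \<partial>lborel) = 0" for R
  proof -
    have "(\<integral>\<zeta>. k \<zeta> * T R \<zeta> \<partial>lborel) = (\<integral>\<zeta>. ?c * (k \<zeta> * (\<integral>y. fR R y * ?E \<zeta> y \<partial>lborel)) \<partial>lborel)"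
      unfolding T_eq by (simp only: mult.left_commute)
    also have "\<dots> = ?c * (\<integral>\<zeta>. k \<zeta> * (\<integral>y. fR R y * ?E \<zeta> y \<partial>lborel) \<partial>lborel)"
      by (rule integral_mult_right_zero)
    also have "(\<integral>\<zeta>. k \<zeta> * (\<integral>y. fR R y * ?E \<zeta> y \<partial>lborel) \<partial>lborel) = (\<integral>y. fR R y * (\<integral>\<zeta>. k \<zeta> * ?E \<zeta> y \<partial>lborel) \<partial>lborel)"
      by (rule integral_swap_bounded_kernel[OF k(1) fR Em E1])
    also have "\<dots> = 0"
      using vanish by (intro integral_eq_zero_AE) (auto simp: fR_def elim!: eventually_mono)
    finally show ?thesis by simp
  qed
  let ?K = "\<integral>\<^sup>+\<zeta>. ennreal ((cmod (k \<zeta>))\<^sup>2) \<partial>lborel"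
  let ?D = "\<lambda>R. \<integral>\<^sup>+\<zeta>. ennreal ((cmod (T R \<zeta> - g \<zeta>))\<^sup>2) \<partial>lborel"
  have K: "?K < top"
    using k(2) by (simp add: L2_fun_def nn_integral_eq_integral)
  have D: "(?D \<longlongrightarrow> 0) at_top" using fg by (simp add: is_L2_fourier_def T_def)
  \<comment> \<open>Cauchy-Schwarz with a free parameter: letting \<open>R\<close> tend to infinity
    removes the second term, and then letting \<open>\<delta>\<close> tend to 0 removes the
    first.\<close>
  have le: "ennreal (cmod (\<integral>\<zeta>. k \<zeta> * g \<zeta> \<partial>lborel)) \<le> ennreal \<delta> * ?K + ennreal (1 / \<delta>) * ?D R"
    if \<delta>: "\<delta> > 0" for \<delta> R
  proof -
    have "(\<integral>\<zeta>. k \<zeta> * g \<zeta> \<partial>lborel) = (\<integral>\<zeta>. k \<zeta> * g \<zeta> - k \<zeta> * T R \<zeta> \<partial>lborel)"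
      using kg kT kT0 by simp
    then have "ennreal (cmod (\<integral>\<zeta>. k \<zeta> * g \<zeta> \<partial>lborel)) \<le> (\<integral>\<^sup>+\<zeta>. ennreal (cmod (k \<zeta> * g \<zeta> - k \<zeta> * T R \<zeta>)) \<partial>lborel)"
      using kg kT by (simp only:) (intro integral_norm_bound_ennreal Bochner_Integration.integrable_diff)
    also have "\<dots> \<le> (\<integral>\<^sup>+\<zeta>. ennreal \<delta> * ennreal ((cmod (k \<zeta>))\<^sup>2) + ennreal (1 / \<delta>) * ennreal ((cmod (T R \<zeta> - g \<zeta>))\<^sup>2) \<partial>lborel)"
    proof (intro nn_integral_mono)
      fix \<zeta>
      define a b where "a = cmod (k \<zeta>)" and "b = cmod (T R \<zeta> - g \<zeta>)"
      have "cmod (k \<zeta> * g \<zeta> - k \<zeta> * T R \<zeta>) = a * b"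
        unfolding a_def b_def norm_mult[symmetric] by (simp add: right_diff_distrib norm_minus_commute)
      also have "a * b \<le> \<delta> * a\<^sup>2 + 1 / \<delta> * b\<^sup>2"
      proof -
        have "0 \<le> a * b" by (simp add: a_def b_def)
        moreover have "2 * (\<delta> * a) * b \<le> (\<delta> * a)\<^sup>2 + b\<^sup>2" by (rule sum_squares_bound)
        then have "(2 * (\<delta> * a) * b) / \<delta> \<le> ((\<delta> * a)\<^sup>2 + b\<^sup>2) / \<delta>" using \<delta> by (intro divide_right_mono) auto
        then have "2 * (a * b) \<le> \<delta> * a\<^sup>2 + 1 / \<delta> * b\<^sup>2"
          using \<delta> by (simp add: add_divide_distrib power_mult_distrib power2_eq_square mult_ac)
        ultimately show ?thesis by linarith
      qed
      finally show "ennreal (cmod (k \<zeta> * g \<zeta> - k \<zeta> * T R \<zeta>))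
          \<le> ennreal \<delta> * ennreal ((cmod (k \<zeta>))\<^sup>2) + ennreal (1 / \<delta>) * ennreal ((cmod (T R \<zeta> - g \<zeta>))\<^sup>2)"
        using \<delta> by (simp add: a_def b_def ennreal_mult[symmetric] ennreal_plus[symmetric] del: ennreal_plus)
    qed
    also have "\<dots> = ennreal \<delta> * ?K + ennreal (1 / \<delta>) * ?D R"
      by (simp add: nn_integral_add nn_integral_cmult)
    finally show ?thesis .
  qed
  have le': "ennreal (cmod (\<integral>\<zeta>. k \<zeta> * g \<zeta> \<partial>lborel)) \<le> ennreal \<delta> * ?K" if \<delta>: "\<delta> > 0" for \<delta>
  proof -
    have "((\<lambda>R. ennreal \<delta> * ?K + ennreal (1 / \<delta>) * ?D R) \<longlongrightarrow> ennreal \<delta> * ?K + ennreal (1 / \<delta>) * 0) at_top"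
      by (intro tendsto_add tendsto_const ennreal_tendsto_cmult D) simp
    from tendsto_lowerbound[OF this, of "ennreal (cmod (\<integral>\<zeta>. k \<zeta> * g \<zeta> \<partial>lborel))"] le[OF \<delta>]
    show ?thesis by simp
  qed
  obtain K' where K': "?K = ennreal K'" "0 \<le> K'" using K by (cases ?K) auto
  have le_K': "cmod (\<integral>\<zeta>. k \<zeta> * g \<zeta> \<partial>lborel) \<le> \<delta> * K'" if "\<delta> > 0" for \<delta>
    using le'[OF that] that K' by (simp add: ennreal_mult[symmetric])
  have "cmod (\<integral>\<zeta>. k \<zeta> * g \<zeta> \<partial>lborel) \<le> 0"
  proof (rule field_le_epsilon)
    fix e :: real assume e: "0 < e"
    have "cmod (\<integral>\<zeta>. k \<zeta> * g \<zeta> \<partial>lborel) \<le> e / (K' + 1) * K'"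
      by (rule le_K') (use e K' in simp)
    also have "\<dots> \<le> e" using e K' by (simp add: field_simps)
    finally show "cmod (\<integral>\<zeta>. k \<zeta> * g \<zeta> \<partial>lborel) \<le> 0 + e" by simp
  qed
  then show ?thesis by simp
qed

text \<open>The argument \<open>\<zeta> + \<eta>\<close> makes this the convolution with the
  reflected kernel, hence the \<open>- u\<close> in \<open>fourier_smoothed_ball\<close>. The
  vanishing condition on the transform involves only \<open>norm u\<close>, so the sign is
  harmless.\<close>

definition smoothed_ball :: "('a::euclidean_space \<Rightarrow> complex) \<Rightarrow> real \<Rightarrow> 'a \<Rightarrow> complex" where
  "smoothed_ball \<Phi> R \<zeta> = (\<integral>\<eta>. \<Phi> \<eta> * indicator (shell 0 R) (\<zeta> + \<eta>) \<partial>lborel)"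

context
  fixes \<Phi> :: "'a::euclidean_space \<Rightarrow> complex"
  assumes \<Phi>: "integrable lborel \<Phi>"
begin

lemma integrable_translate_shell:
  "integrable lborel (\<lambda>\<zeta>. complex_of_real (indicator (shell 0 R) (\<zeta> + \<eta>)))" for \<eta> :: 'a
  using integrable_lborel_affine[OF integrable_indicator_shell[of 0 R], of 1 \<eta>]
  by (simp add: add.commute)

text \<open>By translation invariance, integrating the modulus over \<open>\<zeta>\<close> gives the
  volume of the ball times \<open>cmod (\<Phi> \<eta>)\<close>. The case \<open>u = 0\<close> yields
  integrability of \<open>smoothed_ball\<close>, the general case the interchange in its Fourier
  transform.\<close>

lemma integrable_smoothed_ball_kernel:
  "integrable (lborel \<Otimes>\<^sub>M lborel) (\<lambda>(\<eta>, \<zeta>). \<Phi> \<eta> * indicator (shell 0 R) (\<zeta> + \<eta>) * iexp (u \<bullet> \<zeta>))"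
proof (rule lborel_pair.Fubini_integrable)
  have [measurable]: "\<Phi> \<in> borel_measurable borel"
    using borel_measurable_integrable[OF \<Phi>] by simp
  show "(\<lambda>(\<eta>, \<zeta>). \<Phi> \<eta> * indicator (shell 0 R) (\<zeta> + \<eta>) * iexp (u \<bullet> \<zeta>)) \<in> borel_measurable (lborel \<Otimes>\<^sub>M lborel)"
    by measurable
  have "(\<integral>\<zeta>. norm (\<Phi> \<eta> * indicator (shell 0 R) (\<zeta> + \<eta>) * iexp (u \<bullet> \<zeta>)) \<partial>lborel)
      = (\<integral>\<zeta>. indicator (shell 0 R) (\<zeta> :: 'a) \<partial>lborel) * cmod (\<Phi> \<eta>)" for \<eta>
  proof -
    have "(\<integral>\<zeta>. norm (\<Phi> \<eta> * indicator (shell 0 R) (\<zeta> + \<eta>) * iexp (u \<bullet> \<zeta>)) \<partial>lborel)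
        = (\<integral>\<zeta>. cmod (\<Phi> \<eta>) * indicator (shell 0 R) (\<zeta> + \<eta>) \<partial>lborel)"
      by (intro Bochner_Integration.integral_cong) (auto simp: norm_mult indicator_def)
    also have "\<dots> = cmod (\<Phi> \<eta>) * (\<integral>\<zeta>. indicator (shell 0 R) (\<zeta> + \<eta>) \<partial>lborel)"
      by (rule integral_mult_right_zero)
    also have "(\<integral>\<zeta>. indicator (shell 0 R) (\<zeta> + \<eta>) \<partial>lborel) = (\<integral>\<zeta>. indicator (shell 0 R) (\<zeta> :: 'a) \<partial>lborel :: real)"
      using integral_lborel_affine[of "indicator (shell 0 R) :: 'a \<Rightarrow> real" 1 \<eta>] by (simp add: add.commute)
    finally show ?thesis by simp
  qed
  then show "integrable lborel (\<lambda>\<eta>. \<integral>\<zeta>. norm (case (\<eta>, \<zeta>) of (\<eta>, \<zeta>) \<Rightarrow> \<Phi> \<eta> * indicator (shell 0 R) (\<zeta> + \<eta>) * iexp (u \<bullet> \<zeta>)) \<partial>lborel)"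
    using \<Phi> by simp
  have "integrable lborel (\<lambda>\<zeta>. (\<Phi> \<eta> * indicator (shell 0 R) (\<zeta> + \<eta>)) * iexp (u \<bullet> \<zeta>))" for \<eta>
    using integrable_translate_shell[of R \<eta>] by (intro integrable_mult_iexp) (simp add: of_real_indicator)
  then show "AE \<eta> in lborel. integrable lborel (\<lambda>\<zeta>. case (\<eta>, \<zeta>) of (\<eta>, \<zeta>) \<Rightarrow> \<Phi> \<eta> * indicator (shell 0 R) (\<zeta> + \<eta>) * iexp (u \<bullet> \<zeta>))"
    by simp
qed

lemma integrable_smoothed_ball: "integrable lborel (smoothed_ball \<Phi> R)"
  using lborel_pair.integrable_snd[OF integrable_smoothed_ball_kernel[of R 0]]
  by (simp add: smoothed_ball_def[abs_def])

lemma smoothed_ball_bound: "cmod (smoothed_ball \<Phi> R \<zeta>) \<le> (\<integral>\<eta>. cmod (\<Phi> \<eta>) \<partial>lborel)"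
proof -
  have "cmod (smoothed_ball \<Phi> R \<zeta>) \<le> (\<integral>\<eta>. cmod (\<Phi> \<eta> * indicator (shell 0 R) (\<zeta> + \<eta>)) \<partial>lborel)"
    unfolding smoothed_ball_def by (rule integral_norm_bound)
  also have "\<dots> \<le> (\<integral>\<eta>. cmod (\<Phi> \<eta>) \<partial>lborel)"
    by (rule integral_mono_AE') (use \<Phi> in \<open>auto simp: norm_mult indicator_def\<close>)
  finally show ?thesis .
qed

text \<open>Convolution theorem: after Fubini, the substitution
  \<open>\<xi> = \<zeta> + \<eta>\<close> splits the exponential.\<close>

lemma fourier_smoothed_ball:
  "(\<integral>\<zeta>. smoothed_ball \<Phi> R \<zeta> * iexp (u \<bullet> \<zeta>) \<partial>lborel) =
    (\<integral>\<eta>. \<Phi> \<eta> * iexp ((- u) \<bullet> \<eta>) \<partial>lborel) * (\<integral>\<xi>. indicator (shell 0 R) \<xi> * iexp (u \<bullet> \<xi>) \<partial>lborel)"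
proof -
  have "(\<integral>\<zeta>. smoothed_ball \<Phi> R \<zeta> * iexp (u \<bullet> \<zeta>) \<partial>lborel)
      = (\<integral>\<zeta>. (\<integral>\<eta>. \<Phi> \<eta> * indicator (shell 0 R) (\<zeta> + \<eta>) * iexp (u \<bullet> \<zeta>) \<partial>lborel) \<partial>lborel)"
    unfolding smoothed_ball_def by (simp only: integral_mult_left_zero)
  also have "\<dots> = (\<integral>\<eta>. (\<integral>\<zeta>. \<Phi> \<eta> * indicator (shell 0 R) (\<zeta> + \<eta>) * iexp (u \<bullet> \<zeta>) \<partial>lborel) \<partial>lborel)"
    by (rule lborel_pair.Fubini_integral[OF integrable_smoothed_ball_kernel])
  also have "\<dots> = (\<integral>\<eta>. \<Phi> \<eta> * iexp ((- u) \<bullet> \<eta>) * (\<integral>\<xi>. indicator (shell 0 R) \<xi> * iexp (u \<bullet> \<xi>) \<partial>lborel) \<partial>lborel)"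
  proof (intro Bochner_Integration.integral_cong refl)
    fix \<eta>
    have "(\<integral>\<xi>. indicator (shell 0 R) \<xi> * iexp (u \<bullet> \<xi>) \<partial>lborel)
        = (\<integral>\<zeta>. indicator (shell 0 R) (\<zeta> + \<eta>) * iexp (u \<bullet> (\<zeta> + \<eta>)) \<partial>lborel)"
      using integral_lborel_affine[of "\<lambda>\<xi>. indicator (shell 0 R) \<xi> * iexp (u \<bullet> \<xi>)" 1 \<eta>]
      by (simp add: add.commute)
    then have "\<Phi> \<eta> * iexp ((- u) \<bullet> \<eta>) * (\<integral>\<xi>. indicator (shell 0 R) \<xi> * iexp (u \<bullet> \<xi>) \<partial>lborel)
      = (\<integral>\<zeta>. \<Phi> \<eta> * iexp ((- u) \<bullet> \<eta>) * (indicator (shell 0 R) (\<zeta> + \<eta>) * iexp (u \<bullet> (\<zeta> + \<eta>))) \<partial>lborel)"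
      by simp
    also have "\<dots> = (\<integral>\<zeta>. \<Phi> \<eta> * indicator (shell 0 R) (\<zeta> + \<eta>) * iexp (u \<bullet> \<zeta>) \<partial>lborel)"
    proof (intro Bochner_Integration.integral_cong refl)
      fix \<zeta>
      have "iexp ((- u) \<bullet> \<eta>) * iexp (u \<bullet> (\<zeta> + \<eta>)) = iexp (u \<bullet> \<zeta>)"
        by (simp add: exp_add[symmetric] inner_add_right algebra_simps)
      then show "\<Phi> \<eta> * iexp ((- u) \<bullet> \<eta>) * (indicator (shell 0 R) (\<zeta> + \<eta>) * iexp (u \<bullet> (\<zeta> + \<eta>)))
         = \<Phi> \<eta> * indicator (shell 0 R) (\<zeta> + \<eta>) * iexp (u \<bullet> \<zeta>)"
        by (metis mult.assoc mult.left_commute)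
    qed
    finally show "(\<integral>\<zeta>. \<Phi> \<eta> * indicator (shell 0 R) (\<zeta> + \<eta>) * iexp (u \<bullet> \<zeta>) \<partial>lborel)
       = \<Phi> \<eta> * iexp ((- u) \<bullet> \<eta>) * (\<integral>\<xi>. indicator (shell 0 R) \<xi> * iexp (u \<bullet> \<xi>) \<partial>lborel)" ..
  qed
  also have "\<dots> = (\<integral>\<eta>. \<Phi> \<eta> * iexp ((- u) \<bullet> \<eta>) \<partial>lborel) * (\<integral>\<xi>. indicator (shell 0 R) \<xi> * iexp (u \<bullet> \<xi>) \<partial>lborel)"
    by (rule integral_mult_left_zero)
  finally show ?thesis .
qed

end

text \<open>The smoothed ball contributes nothing: its product with the phase of \<open>x\<close>
  has, at \<open>y\<close>, a transform containing as a factor the transform of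
  \<open>\<Phi>\<close> at \<open>y - x\<close>. This factor vanishes for \<open>y\<close> outside
  the \<open>\<epsilon>\<close>-ball about \<open>x\<close>, and inside that ball \<open>f\<close>
  vanishes, so the pairing with \<open>g\<close> is 0.\<close>

lemma shell_sum_eq_boundary_multiplier:
  fixes f g :: "'a::euclidean_space \<Rightarrow> complex"
  assumes f: "L2_fun f" and fg: "is_L2_fourier f g"
    and f0: "AE y in lborel. y \<in> ball x \<epsilon> \<longrightarrow> f y = 0"
    and \<Phi>: "integrable lborel \<Phi>" "\<And>u. norm u \<ge> \<epsilon> \<Longrightarrow> (\<integral>\<eta>. \<Phi> \<eta> * iexp (u \<bullet> \<eta>) \<partial>lborel) = 0"
  shows "shell_sum g 0 R x = (\<integral>\<zeta>. (indicator (shell 0 R) \<zeta> - smoothed_ball \<Phi> R \<zeta>) * g \<zeta> * iexp (x \<bullet> \<zeta>) \<partial>lborel)"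
proof -
  let ?M = "smoothed_ball \<Phi> R"
  have g: "L2_fun g" using fg by (simp add: is_L2_fourier_def)
  have M: "integrable lborel ?M" by (rule integrable_smoothed_ball[OF \<Phi>(1)])
  have M2: "L2_fun ?M" by (rule L2_fun_bounded_integrable[OF M smoothed_ball_bound[OF \<Phi>(1)]])
  let ?k = "\<lambda>\<zeta>. ?M \<zeta> * iexp (x \<bullet> \<zeta>)"
  have k: "integrable lborel ?k" by (rule integrable_mult_iexp[OF M])
  have k2: "L2_fun ?k"
    by (rule L2_fun_bounded_integrable[OF k, of "\<integral>\<eta>. cmod (\<Phi> \<eta>) \<partial>lborel"])
       (simp add: norm_mult smoothed_ball_bound[OF \<Phi>(1)])
  have "(\<integral>\<zeta>. ?k \<zeta> * g \<zeta> \<partial>lborel) = 0"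
  proof (rule L2_fourier_pairing_eq_0[OF f fg k k2])
    show "AE y in lborel. f y * (\<integral>\<zeta>. ?k \<zeta> * exp (- \<i> * complex_of_real (y \<bullet> \<zeta>)) \<partial>lborel) = 0"
      using f0
    proof eventually_elim
      fix y assume y: "y \<in> ball x \<epsilon> \<longrightarrow> f y = 0"
      show "f y * (\<integral>\<zeta>. ?k \<zeta> * exp (- \<i> * complex_of_real (y \<bullet> \<zeta>)) \<partial>lborel) = 0"
      proof (cases "y \<in> ball x \<epsilon>")
        case False
        have "?k \<zeta> * exp (- \<i> * complex_of_real (y \<bullet> \<zeta>)) = ?M \<zeta> * iexp ((x - y) \<bullet> \<zeta>)" for \<zeta>
          by (simp add: mult.assoc exp_add[symmetric] inner_diff_left algebra_simps)
        then have "(\<integral>\<zeta>. ?k \<zeta> * exp (- \<i> * complex_of_real (y \<bullet> \<zeta>)) \<partial>lborel) = (\<integral>\<zeta>. ?M \<zeta> * iexp ((x - y) \<bullet> \<zeta>) \<partial>lborel)"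
          by presburger
        also have "\<dots> = 0"
        proof -
          have "norm (- (x - y)) \<ge> \<epsilon>" using False by (simp add: dist_norm norm_minus_commute)
          then show ?thesis unfolding fourier_smoothed_ball[OF \<Phi>(1)] using \<Phi>(2) by simp
        qed
        finally show ?thesis by simp
      qed (use y in simp)
    qed
  qed
  then have Mg: "(\<integral>\<zeta>. ?M \<zeta> * g \<zeta> * iexp (x \<bullet> \<zeta>) \<partial>lborel) = 0"
    by (simp add: mult_ac)
  have "(\<integral>\<zeta>. (indicator (shell 0 R) \<zeta> - ?M \<zeta>) * g \<zeta> * iexp (x \<bullet> \<zeta>) \<partial>lborel)
     = (\<integral>\<zeta>. indicator (shell 0 R) \<zeta> * g \<zeta> * iexp (x \<bullet> \<zeta>) - ?M \<zeta> * g \<zeta> * iexp (x \<bullet> \<zeta>) \<partial>lborel)"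
    by (simp add: left_diff_distrib)
  also have "\<dots> = shell_sum g 0 R x - 0"
    unfolding shell_sum_def Mg[symmetric]
    by (intro Bochner_Integration.integral_diff integrable_mult_iexp integrable_shell_L2 integrable_mult_L2 g M2)
  finally show ?thesis by simp
qed

text \<open>An interval of length \<open>2 * t\<close> contains at most \<open>2 * t + 1\<close>
  integers. The \<open>t\<close> inside the set is bound there: the indicator is that of the
  half-line from \<open>\<bar>s - real k\<bar>\<close> on, evaluated at the outer \<open>t\<close>,
  as it occurs in \<open>boundary_multiplier_bound\<close>.\<close>

lemma sum_indicator_near_le:
  assumes "0 \<le> t"
  shows "(\<Sum>k<n. indicator {t. \<bar>s - real k\<bar> \<le> t} t) \<le> 2 * t + (1::real)"
proof -
  let ?A = "{k. k < n \<and> \<bar>s - real k\<bar> \<le> t}"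
  have "(\<Sum>k<n. indicator {t. \<bar>s - real k\<bar> \<le> t} t) = (\<Sum>k<n. if \<bar>s - real k\<bar> \<le> t then 1 else (0::real))"
    by (intro sum.cong) (auto simp: indicator_def)
  also have "\<dots> = real (card ?A)"
    by (subst sum.inter_filter[symmetric]) auto
  finally have eq: "(\<Sum>k<n. indicator {t. \<bar>s - real k\<bar> \<le> t} t) = real (card ?A)" .
  have "card ?A = card (int ` ?A)" by (simp add: card_image)
  also have "\<dots> \<le> card {\<lceil>s - t\<rceil>..\<lfloor>s + t\<rfloor>}"
    by (intro card_mono) (auto simp: le_floor_iff ceiling_le_iff abs_le_iff)
  also have "\<dots> = nat (\<lfloor>s + t\<rfloor> + 1 - \<lceil>s - t\<rceil>)" by simp
  finally have "real (card ?A) \<le> real (nat (\<lfloor>s + t\<rfloor> + 1 - \<lceil>s - t\<rceil>))" by simp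
  also have "\<dots> \<le> 2 * t + 1" using assms by linarith
  finally show ?thesis unfolding eq .
qed

section \<open>Square sums of the boundary multipliers over integer radii\<close>

context
  fixes \<Phi> :: "'a::euclidean_space \<Rightarrow> complex"
  assumes \<Phi>: "integrable lborel \<Phi>" and \<Phi>_moment: "integrable lborel (\<lambda>\<eta>. norm \<eta> * cmod (\<Phi> \<eta>))"
    and \<Phi>_1: "integral\<^sup>L lborel \<Phi> = 1"
begin

abbreviation boundary_multiplier :: "real \<Rightarrow> 'a \<Rightarrow> complex" where
  "boundary_multiplier R \<zeta> \<equiv> indicator (shell 0 R) \<zeta> - smoothed_ball \<Phi> R \<zeta>"

lemma integrable_mult_indicator_near:
  "integrable lborel (\<lambda>\<eta>. cmod (\<Phi> \<eta>) * indicator {t. r \<le> t} (norm \<eta>))"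
proof (rule Bochner_Integration.integrable_bound[OF \<Phi>])
  have [measurable]: "\<Phi> \<in> borel_measurable borel" using borel_measurable_integrable[OF \<Phi>] by simp
  show "(\<lambda>\<eta>. cmod (\<Phi> \<eta>) * indicator {t. r \<le> t} (norm \<eta>)) \<in> borel_measurable lborel" by measurable
qed (auto simp: indicator_def)

text \<open>Since \<open>\<Phi>\<close> has integral 1, the multiplier averages against
  \<open>\<Phi>\<close> the change of the ball's indicator between \<open>\<zeta>\<close> and
  \<open>\<zeta> + \<eta>\<close>. That change is 0 unless the step crosses the sphere of radius
  \<open>R\<close>, which forces
  \<open>norm \<eta> \<ge> \<bar>norm \<zeta> - R\<bar>\<close>.\<close>

lemma boundary_multiplier_bound:
  "cmod (boundary_multiplier R \<zeta>) \<le> (\<integral>\<eta>. cmod (\<Phi> \<eta>) * indicator {t. \<bar>norm \<zeta> - R\<bar> \<le> t} (norm \<eta>) \<partial>lborel)"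
proof -
  have [measurable]: "\<Phi> \<in> borel_measurable borel" using borel_measurable_integrable[OF \<Phi>] by simp
  have i1: "integrable lborel (\<lambda>\<eta>. \<Phi> \<eta> * indicator (shell 0 R) \<zeta>)" using \<Phi> by simp
  have i2: "integrable lborel (\<lambda>\<eta>. \<Phi> \<eta> * indicator (shell 0 R) (\<zeta> + \<eta>))"
    by (rule Bochner_Integration.integrable_bound[OF \<Phi>]) (auto simp: indicator_def)
  have "boundary_multiplier R \<zeta> = (\<integral>\<eta>. \<Phi> \<eta> * indicator (shell 0 R) \<zeta> - \<Phi> \<eta> * indicator (shell 0 R) (\<zeta> + \<eta>) \<partial>lborel)"
    using i1 i2 by (simp add: smoothed_ball_def \<Phi>_1)
  then have "cmod (boundary_multiplier R \<zeta>)
      \<le> (\<integral>\<eta>. cmod (\<Phi> \<eta> * indicator (shell 0 R) \<zeta> - \<Phi> \<eta> * indicator (shell 0 R) (\<zeta> + \<eta>)) \<partial>lborel)"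
    by (simp only: integral_norm_bound)
  also have "\<dots> \<le> (\<integral>\<eta>. cmod (\<Phi> \<eta>) * indicator {t. \<bar>norm \<zeta> - R\<bar> \<le> t} (norm \<eta>) \<partial>lborel)"
  proof (rule integral_mono)
    show "integrable lborel (\<lambda>\<eta>. cmod (\<Phi> \<eta> * indicator (shell 0 R) \<zeta> - \<Phi> \<eta> * indicator (shell 0 R) (\<zeta> + \<eta>)))"
      using i1 i2 by (intro integrable_norm Bochner_Integration.integrable_diff)
    show "integrable lborel (\<lambda>\<eta>. cmod (\<Phi> \<eta>) * indicator {t. \<bar>norm \<zeta> - R\<bar> \<le> t} (norm \<eta>))"
      by (rule integrable_mult_indicator_near)
    fix \<eta>
    have "norm (\<zeta> + \<eta>) \<le> norm \<zeta> + norm \<eta>" "norm \<zeta> \<le> norm (\<zeta> + \<eta>) + norm \<eta>"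
      using norm_triangle_ineq[of \<zeta> \<eta>] norm_triangle_ineq4[of "\<zeta> + \<eta>" \<eta>] by simp_all
    then show "cmod (\<Phi> \<eta> * indicator (shell 0 R) \<zeta> - \<Phi> \<eta> * indicator (shell 0 R) (\<zeta> + \<eta>))
        \<le> cmod (\<Phi> \<eta>) * indicator {t. \<bar>norm \<zeta> - R\<bar> \<le> t} (norm \<eta>)"
      by (auto simp: indicator_def shell_def)
  qed
  finally show ?thesis .
qed

lemma boundary_multiplier_le: "cmod (boundary_multiplier R \<zeta>) \<le> (\<integral>\<eta>. cmod (\<Phi> \<eta>) \<partial>lborel)"
proof -
  have "(\<integral>\<eta>. cmod (\<Phi> \<eta>) * indicator {t. \<bar>norm \<zeta> - R\<bar> \<le> t} (norm \<eta>) \<partial>lborel) \<le> (\<integral>\<eta>. cmod (\<Phi> \<eta>) \<partial>lborel)"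
    by (rule integral_mono[OF integrable_mult_indicator_near]) (use \<Phi> in \<open>auto simp: indicator_def\<close>)
  with boundary_multiplier_bound[of R \<zeta>] show ?thesis by linarith
qed

text \<open>One factor of each square is bounded by the L1 norm of \<open>\<Phi>\<close>. Summing
  the other over \<open>k\<close> counts the integers within \<open>norm \<eta>\<close> of
  \<open>norm \<zeta>\<close>, so the first moment of \<open>\<Phi>\<close> bounds the sum uniformly
  in \<open>n\<close> and \<open>\<zeta>\<close>.\<close>

lemma sum_boundary_multiplier_square_le:
  "(\<Sum>k<n. (cmod (boundary_multiplier (real k) \<zeta>))\<^sup>2) \<le>
    (\<integral>\<eta>. cmod (\<Phi> \<eta>) \<partial>lborel) * (\<integral>\<eta>. (2 * norm \<eta> + 1) * cmod (\<Phi> \<eta>) \<partial>lborel)"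
proof -
  let ?L = "\<integral>\<eta>. cmod (\<Phi> \<eta>) \<partial>lborel"
  have "(\<Sum>k<n. (cmod (boundary_multiplier (real k) \<zeta>))\<^sup>2) \<le> (\<Sum>k<n. ?L * cmod (boundary_multiplier (real k) \<zeta>))"
    unfolding power2_eq_square by (intro sum_mono mult_right_mono boundary_multiplier_le) simp
  also have "\<dots> \<le> (\<Sum>k<n. ?L * (\<integral>\<eta>. cmod (\<Phi> \<eta>) * indicator {t. \<bar>norm \<zeta> - real k\<bar> \<le> t} (norm \<eta>) \<partial>lborel))"
    by (intro sum_mono mult_left_mono boundary_multiplier_bound) simp
  also have "\<dots> = ?L * (\<integral>\<eta>. (\<Sum>k<n. cmod (\<Phi> \<eta>) * indicator {t. \<bar>norm \<zeta> - real k\<bar> \<le> t} (norm \<eta>)) \<partial>lborel)"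
    by (subst Bochner_Integration.integral_sum[OF integrable_mult_indicator_near]) (rule sum_distrib_left[symmetric])
  also have "\<dots> \<le> ?L * (\<integral>\<eta>. (2 * norm \<eta> + 1) * cmod (\<Phi> \<eta>) \<partial>lborel)"
  proof (intro mult_left_mono integral_mono)
    show "integrable lborel (\<lambda>\<eta>. \<Sum>k<n. cmod (\<Phi> \<eta>) * indicator {t. \<bar>norm \<zeta> - real k\<bar> \<le> t} (norm \<eta>))"
      by (intro Bochner_Integration.integrable_sum integrable_mult_indicator_near)
    show "integrable lborel (\<lambda>\<eta>. (2 * norm \<eta> + 1) * cmod (\<Phi> \<eta>))"
      using \<Phi> \<Phi>_moment by (simp add: distrib_right mult.assoc)
    show "(\<Sum>k<n. cmod (\<Phi> \<eta>) * indicator {t. \<bar>norm \<zeta> - real k\<bar> \<le> t} (norm \<eta>)) \<le> (2 * norm \<eta> + 1) * cmod (\<Phi> \<eta>)" for \<eta>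
      unfolding sum_distrib_left[symmetric]
      by (subst mult.commute) (intro mult_right_mono sum_indicator_near_le norm_ge_zero)
  qed simp
  finally show ?thesis .
qed

text \<open>The Gaussian bound is taken over the whole space, with \<open>D\<close> the total
  Gaussian mass. Summability over \<open>k\<close> comes from the pointwise bound on the square sum
  of the multipliers, applied under the integral of the squared modulus of \<open>g\<close>.\<close>

lemma AE_boundary_multiplier_sum_tendsto_0:
  assumes g: "L2_fun g"
  shows "AE x in lborel. (\<lambda>k. ennreal (exp (- (norm x)\<^sup>2 / 2) *
    (cmod (\<integral>\<zeta>. boundary_multiplier (real k) \<zeta> * g \<zeta> * iexp (x \<bullet> \<zeta>) \<partial>lborel))\<^sup>2)) \<longlonglongrightarrow> 0"
proof (rule AE_tendsto_0_if_nn_integral_summable)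
  let ?w = "\<lambda>x::'a. exp (- (norm x)\<^sup>2 / 2)"
  let ?h = "\<lambda>k \<zeta>. boundary_multiplier (real k) \<zeta> * g \<zeta>"
  let ?T = "\<lambda>k x. \<integral>\<zeta>. ?h k \<zeta> * iexp (x \<bullet> \<zeta>) \<partial>lborel"
  let ?B = "(\<integral>\<eta>. cmod (\<Phi> \<eta>) \<partial>lborel) * (\<integral>\<eta>. (2 * norm \<eta> + 1) * cmod (\<Phi> \<eta>) \<partial>lborel)"
  let ?G = "\<lambda>\<zeta>. ennreal ((cmod (g \<zeta>))\<^sup>2)"
  define C where "C = ennreal (sqrt (2 * pi) ^ DIM('a))"
  define D where "D = ennreal (\<integral>x. ?w x \<partial>lborel)"
  have [measurable]: "g \<in> borel_measurable borel" using g by (rule L2_fun_borel)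
  have m: "integrable lborel (boundary_multiplier (real k))" for k
  proof -
    have "integrable lborel (\<lambda>\<zeta>::'a. complex_of_real (indicator (shell 0 (real k)) \<zeta>))"
      by (rule integrable_of_real[OF integrable_indicator_shell])
    then show ?thesis
      using integrable_smoothed_ball[OF \<Phi>] by (simp add: of_real_indicator)
  qed
  have h: "integrable lborel (?h k)" for k
    by (rule integrable_mult_L2[OF L2_fun_bounded_integrable[OF m boundary_multiplier_le] g])
  have hm[measurable]: "?h k \<in> borel_measurable borel" for k
    using borel_measurable_integrable[OF h] by simp
  have Tm: "?T k \<in> borel_measurable borel" for k
    by (rule measurable_fourier_integral[OF hm])
  then show "(\<lambda>x. ennreal (?w x * (cmod (?T k x))\<^sup>2)) \<in> borel_measurable lborel" for k
    by simp
  have w: "(\<integral>\<^sup>+\<eta>. indicator UNIV \<eta> * ennreal (?w (\<xi> - \<eta>)) \<partial>lborel) \<le> D" for \<xi>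
    using nn_integral_lborel_reflect[of "\<lambda>x. ennreal (?w x)" \<xi>] nn_integral_eq_integral[OF integrable_gaussian[where 'a='a]]
    by (simp add: D_def)
  have "(\<Sum>k. \<integral>\<^sup>+x. ennreal (?w x * (cmod (?T k x))\<^sup>2) \<partial>lborel) \<le> (\<Sum>k. C * (D * (\<integral>\<^sup>+\<zeta>. ennreal ((cmod (?h k \<zeta>))\<^sup>2) \<partial>lborel)))"
    unfolding C_def
    by (intro suminf_le summableI gaussian_weighted_fourier_bound[OF h, where A=UNIV] w) auto
  also have "\<dots> = C * (D * (\<integral>\<^sup>+\<zeta>. (\<Sum>k. ennreal ((cmod (?h k \<zeta>))\<^sup>2)) \<partial>lborel))"
    by (subst nn_integral_suminf) auto
  also have "\<dots> \<le> C * (D * (\<integral>\<^sup>+\<zeta>. ennreal ?B * ?G \<zeta> \<partial>lborel))"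
  proof (intro mult_left_mono nn_integral_mono suminf_le_const summableI)
    fix \<zeta> n
    have "(\<Sum>k<n. (cmod (?h k \<zeta>))\<^sup>2) = (\<Sum>k<n. (cmod (boundary_multiplier (real k) \<zeta>))\<^sup>2) * (cmod (g \<zeta>))\<^sup>2"
      by (simp add: norm_mult power_mult_distrib sum_distrib_right)
    also have "\<dots> \<le> ?B * (cmod (g \<zeta>))\<^sup>2"
      by (intro mult_right_mono sum_boundary_multiplier_square_le) simp
    finally have "ennreal (\<Sum>k<n. (cmod (?h k \<zeta>))\<^sup>2) \<le> ennreal (?B * (cmod (g \<zeta>))\<^sup>2)"
      by (rule ennreal_leI)
    then show "(\<Sum>k<n. ennreal ((cmod (?h k \<zeta>))\<^sup>2)) \<le> ennreal ?B * ?G \<zeta>"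
      by (simp add: sum_ennreal ennreal_mult'')
  qed simp_all
  also have "\<dots> = C * (D * (ennreal ?B * (\<integral>\<^sup>+\<zeta>. ?G \<zeta> \<partial>lborel)))"
    by (subst nn_integral_cmult) auto
  also have "\<dots> < \<infinity>"
    using g by (simp add: L2_fun_def nn_integral_eq_integral ennreal_mult_less_top C_def D_def)
  finally show "(\<Sum>k. \<integral>\<^sup>+x. ennreal (?w x * (cmod (?T k x))\<^sup>2) \<partial>lborel) < \<infinity>" .
qed

end

lemma tendsto_0_if_weighted_square_tendsto_0:
  assumes c: "c > 0" and lim: "(\<lambda>k. ennreal (c * (cmod (z k))\<^sup>2)) \<longlonglongrightarrow> 0"
  shows "z \<longlonglongrightarrow> 0"
proof -
  have "(\<lambda>k. c * (cmod (z k))\<^sup>2) \<longlonglongrightarrow> 0"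
    using tendsto_enn2real[of "\<lambda>k. ennreal (c * (cmod (z k))\<^sup>2)" 0 sequentially] lim c by simp
  then have "(\<lambda>k. (1 / c) * (c * (cmod (z k))\<^sup>2)) \<longlonglongrightarrow> (1 / c) * 0"
    by (rule tendsto_mult_left)
  then have "(\<lambda>k. (cmod (z k))\<^sup>2) \<longlonglongrightarrow> 0" using c by simp
  then have "(\<lambda>k. sqrt ((cmod (z k))\<^sup>2)) \<longlonglongrightarrow> sqrt 0" by (rule tendsto_real_sqrt)
  then show ?thesis by (simp add: tendsto_norm_zero_iff)
qed

text \<open>The kernel, and with it the exceptional null set, depends on the radius
  \<open>\<epsilon>\<close> of a ball about \<open>x\<close> inside \<open>\<Omega>\<close>. The
  radii \<open>1 / real (Suc n)\<close> give only countably many null sets and suffice for every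
  point of an open set.\<close>

lemma AE_shell_sum_nat_tendsto_0:
  fixes f g :: "'a::euclidean_space \<Rightarrow> complex"
  assumes f: "L2_fun f" and fg: "is_L2_fourier f g" and \<Omega>: "open \<Omega>"
    and f0: "AE x in lborel. x \<in> \<Omega> \<longrightarrow> f x = 0"
  shows "AE x in lborel. x \<in> \<Omega> \<longrightarrow> (\<lambda>k. shell_sum g 0 (real k) x) \<longlonglongrightarrow> 0"
proof -
  have g: "L2_fun g" using fg by (simp add: is_L2_fourier_def)
  have "AE x in lborel. ball x (1 / real (Suc n)) \<subseteq> \<Omega> \<longrightarrow> (\<lambda>k. shell_sum g 0 (real k) x) \<longlonglongrightarrow> 0" for n
  proof -
    define \<epsilon> where "\<epsilon> = 1 / real (Suc n)"
    have "\<epsilon> > 0" by (simp add: \<epsilon>_def)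
    then obtain \<Phi> :: "'a \<Rightarrow> complex" where \<Phi>: "integrable lborel \<Phi>"
      "integrable lborel (\<lambda>\<eta>. norm \<eta> * cmod (\<Phi> \<eta>))" "integral\<^sup>L lborel \<Phi> = 1"
      "\<And>u. norm u \<ge> \<epsilon> \<Longrightarrow> (\<integral>\<eta>. \<Phi> \<eta> * iexp (u \<bullet> \<eta>) \<partial>lborel) = 0"
      by (rule localizing_kernel) blast
    show ?thesis
      using AE_boundary_multiplier_sum_tendsto_0[OF \<Phi>(1-3) g]
    proof eventually_elim
      fix x
      assume lim: "(\<lambda>k. ennreal (exp (- (norm x)\<^sup>2 / 2) * (cmod (\<integral>\<zeta>. (indicator (shell 0 (real k)) \<zeta> -
         smoothed_ball \<Phi> (real k) \<zeta>) * g \<zeta> * iexp (x \<bullet> \<zeta>) \<partial>lborel))\<^sup>2)) \<longlonglongrightarrow> 0"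
      show "ball x (1 / real (Suc n)) \<subseteq> \<Omega> \<longrightarrow> (\<lambda>k. shell_sum g 0 (real k) x) \<longlonglongrightarrow> 0"
      proof
        assume "ball x (1 / real (Suc n)) \<subseteq> \<Omega>"
        then have "AE y in lborel. y \<in> ball x \<epsilon> \<longrightarrow> f y = 0"
          using f0 by (auto simp: \<epsilon>_def elim!: eventually_mono)
        from shell_sum_eq_boundary_multiplier[OF f fg this \<Phi>(1,4)]
        have "(\<lambda>k. ennreal (exp (- (norm x)\<^sup>2 / 2) * (cmod (shell_sum g 0 (real k) x))\<^sup>2)) \<longlonglongrightarrow> 0"
          using lim by simp
        then show "(\<lambda>k. shell_sum g 0 (real k) x) \<longlonglongrightarrow> 0"
          by (rule tendsto_0_if_weighted_square_tendsto_0[rotated]) simp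
      qed
    qed
  qed
  then have "AE x in lborel. \<forall>n. ball x (1 / real (Suc n)) \<subseteq> \<Omega> \<longrightarrow> (\<lambda>k. shell_sum g 0 (real k) x) \<longlonglongrightarrow> 0"
    by (simp only: AE_all_countable) blast
  then show ?thesis
  proof eventually_elim
    fix x
    assume *: "\<forall>n. ball x (1 / real (Suc n)) \<subseteq> \<Omega> \<longrightarrow> (\<lambda>k. shell_sum g 0 (real k) x) \<longlonglongrightarrow> 0"
    show "x \<in> \<Omega> \<longrightarrow> (\<lambda>k. shell_sum g 0 (real k) x) \<longlonglongrightarrow> 0"
    proof
      assume "x \<in> \<Omega>"
      then obtain e where e: "e > 0" "ball x e \<subseteq> \<Omega>" using \<Omega> open_contains_ball by blast
      obtain n where "1 / real (Suc n) < e" using e(1) nat_approx_posE by blast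
      then have "ball x (1 / real (Suc n)) \<subseteq> \<Omega>" using e(2) by (auto intro: order_less_trans)
      with * show "(\<lambda>k. shell_sum g 0 (real k) x) \<longlonglongrightarrow> 0" by blast
    qed
  qed
qed

section \<open>Convergence along all radii\<close>

lemma shell_sum_tendsto_0:
  fixes g :: "'a::euclidean_space \<Rightarrow> complex"
  assumes g: "L2_fun g"
    and nat: "(\<lambda>k. shell_sum g 0 (real k) x) \<longlonglongrightarrow> 0"
    and var: "(\<lambda>k. SUP n. ennreal (exp (- (norm x)\<^sup>2 / 2) * (dyadic_variation g (1 + real k) n x)\<^sup>2)) \<longlonglongrightarrow> 0"
  shows "((\<lambda>R. shell_sum g 0 R x) \<longlongrightarrow> 0) at_top"
proof (rule tendstoI)
  fix e :: real assume e: "e > 0"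
  let ?w = "exp (- (norm x)\<^sup>2 / 2)"
  have "\<forall>\<^sub>F k in sequentially. cmod (shell_sum g 0 (real k) x) < e / 2"
    using tendstoD[OF nat, of "e / 2"] e by (simp add: dist_norm)
  then obtain N1 where N1: "\<And>k. k \<ge> N1 \<Longrightarrow> cmod (shell_sum g 0 (real k) x) < e / 2"
    unfolding eventually_sequentially by blast
  have "0 < ennreal (?w * (e / 2)\<^sup>2)" using e by simp
  from order_tendstoD(2)[OF var this]
  obtain N2 where N2: "\<And>k. k \<ge> N2 \<Longrightarrow> (SUP n. ennreal (?w * (dyadic_variation g (1 + real k) n x)\<^sup>2)) < ennreal (?w * (e / 2)\<^sup>2)"
    unfolding eventually_sequentially by blast
  show "\<forall>\<^sub>F R in at_top. dist (shell_sum g 0 R x) 0 < e"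
    using eventually_ge_at_top[of "1 + real (max N1 N2)"]
  proof eventually_elim
    fix R :: real assume R: "1 + real (max N1 N2) \<le> R"
    \<comment> \<open>\<open>R\<close> lies between \<open>1 + real k\<close> and
      \<open>2 + real k\<close>; the offset 1 matches the variations, which are indexed from radius
      1.\<close>
    define k where "k = nat \<lfloor>R - 1\<rfloor>"
    have k: "1 + real k \<le> R" "R \<le> 1 + real k + 1" and kN: "max N1 N2 \<le> k"
      using R unfolding k_def by linarith+
    have "ennreal (?w * (cmod (shell_sum g (1 + real k) R x))\<^sup>2) < ennreal (?w * (e / 2)\<^sup>2)"
      using shell_sum_le_SUP_dyadic_variation[OF g k, of ?w x] N2[of k] kN by (simp add: order_le_less_trans)
    then have "(cmod (shell_sum g (1 + real k) R x))\<^sup>2 < (e / 2)\<^sup>2"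
      by (subst (asm) ennreal_less_iff) auto
    then have "cmod (shell_sum g (1 + real k) R x) < e / 2"
      by (rule power2_less_imp_less) (use e in simp)
    moreover have "cmod (shell_sum g 0 (1 + real k) x) < e / 2"
      using N1[of "Suc k"] kN by simp
    moreover have "shell_sum g 0 R x = shell_sum g 0 (1 + real k) x + shell_sum g (1 + real k) R x"
      using k by (intro shell_sum_add[OF g]) auto
    ultimately show "dist (shell_sum g 0 R x) 0 < e"
      using norm_triangle_ineq[of "shell_sum g 0 (1 + real k) x" "shell_sum g (1 + real k) R x"] by (simp add: dist_norm)
  qed
qed

text \<open>The frequency set is the open ball of radius \<open>root (2 * m) lam\<close>, so
  \<open>m\<close> only reparametrises the radius.\<close>

lemma spectral_proj_eq_shell_sum:
  fixes g :: "'a::euclidean_space \<Rightarrow> complex"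
  assumes m: "m \<ge> 1" and lam: "lam > 0"
  shows "spectral_proj m g lam x =
    complex_of_real ((2 * pi) powr (- real DIM('a) / 2)) * shell_sum g 0 (root (2 * m) lam) x"
proof -
  have "norm \<xi> ^ (2 * m) < lam \<longleftrightarrow> norm \<xi> < root (2 * m) lam" for \<xi> :: 'a
    using real_root_less_iff[of "2 * m" "norm \<xi> ^ (2 * m)" lam] m by (simp add: real_root_power_cancel)
  then have "{\<xi> :: 'a. norm \<xi> ^ (2 * m) < lam} = shell 0 (root (2 * m) lam)"
    by (auto simp: shell_def)
  then show ?thesis
    by (simp add: spectral_proj_def shell_sum_def set_lebesgue_integral_def scaleR_conv_of_real
        of_real_indicator mult.assoc)
qed

lemma filterlim_root_at_top:
  assumes "n > 0"
  shows "filterlim (root n) at_top at_top"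
  unfolding filterlim_at_top
proof
  fix Z :: real
  show "\<forall>\<^sub>F x in at_top. Z \<le> root n x"
    using eventually_ge_at_top[of "(max 0 Z) ^ n"]
  proof eventually_elim
    fix x :: real assume "(max 0 Z) ^ n \<le> x"
    then have "root n ((max 0 Z) ^ n) \<le> root n x" using assms by simp
    then show "Z \<le> root n x" using assms by (simp add: real_root_power_cancel)
  qed
qed

theorem theorem1p1:
  fixes f g :: "'a::euclidean_space \<Rightarrow> complex" and \<Omega> :: "'a set" and m :: nat
  assumes "m \<ge> 1"
    and "L2_fun f"
    and "is_L2_fourier f g"
    and "open \<Omega>"
    and "AE x in lborel. x \<in> \<Omega> \<longrightarrow> f x = 0"
  shows "AE x in lborel. x \<in> \<Omega> \<longrightarrow> ((\<lambda>lam. spectral_proj m g lam x) \<longlongrightarrow> 0) at_top"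
proof -
  let ?c = "complex_of_real ((2 * pi) powr (- real DIM('a) / 2))"
  have g: "L2_fun g" using assms(3) by (simp add: is_L2_fourier_def)
  show ?thesis
    \<comment> \<open>Smallness at integer radii uses the vanishing of \<open>f\<close> on
      \<open>\<Omega>\<close>; small oscillation between them holds at almost every point for any
      square integrable \<open>g\<close>.\<close>
    using AE_shell_sum_nat_tendsto_0[OF assms(2-5)] AE_dyadic_variation_tendsto_0[OF g]
  proof eventually_elim
    fix x
    assume nat: "x \<in> \<Omega> \<longrightarrow> (\<lambda>k. shell_sum g 0 (real k) x) \<longlonglongrightarrow> 0"
      and var: "(\<lambda>k. SUP n. ennreal (exp (- (norm x)\<^sup>2 / 2) * (dyadic_variation g (1 + real k) n x)\<^sup>2)) \<longlonglongrightarrow> 0"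
    show "x \<in> \<Omega> \<longrightarrow> ((\<lambda>lam. spectral_proj m g lam x) \<longlongrightarrow> 0) at_top"
    proof
      assume "x \<in> \<Omega>"
      with nat var have "((\<lambda>R. shell_sum g 0 R x) \<longlongrightarrow> 0) at_top"
        by (intro shell_sum_tendsto_0[OF g]) auto
      moreover have "filterlim (root (2 * m)) at_top at_top"
        using assms(1) by (intro filterlim_root_at_top) simp
      ultimately have "((\<lambda>lam. shell_sum g 0 (root (2 * m) lam) x) \<longlongrightarrow> 0) at_top"
        by (rule filterlim_compose)
      then have "((\<lambda>lam. ?c * shell_sum g 0 (root (2 * m) lam) x) \<longlongrightarrow> 0) at_top"
        by (rule tendsto_mult_right_zero)
      \<comment> \<open>The identification with a ball is stated for positive \<open>lam\<close>,
        hence the eventual equality.\<close>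
      moreover have "\<forall>\<^sub>F lam in at_top. ?c * shell_sum g 0 (root (2 * m) lam) x = spectral_proj m g lam x"
        using eventually_gt_at_top[of 0] by eventually_elim (simp add: spectral_proj_eq_shell_sum[OF assms(1)])
      ultimately show "((\<lambda>lam. spectral_proj m g lam x) \<longlongrightarrow> 0) at_top"
        by (rule Lim_transform_eventually)
    qed
  qed
qed

end
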